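(* Let $d\ge2$. For any $\nu\in(0,1]$ and $\epsilon\in(0,1)$, there exists $\delta_1>0$ depending only on $d,\epsilon,\nu$ such that if a domain $\Omega\subsetneq\mathbb R^d$ satisfies the totally $\delta_1$-exterior Reifenberg condition $\langle\mathrm{TER}_{\delta_1}\rangle$ with constants $0<R_0\le R_\infty<\infty$, then there exists a measurable function $\phi:\Omega\to\mathbb R$ satisfying the following: (1) For any $(\alpha^{ij})_{d\times d}\in\mathrm M(\nu^2,1)$, $\sum_{i,j}\alpha^{ij}D_{ij}\phi\le0$ in the sense of distributions on $\Omega$. (2) There exists $N=N(d,\nu,\epsilon,R_0/R_\infty)>0$ such that $$N^{-1}\rho(x)^{1-\epsilon}\le\phi(x)\le N\rho(x)^{1-\epsilon}\quad\text{for all }x\in\Omega.$$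
   Context: $\rho(x)=d(x,\partial\Omega)$. $\mathrm M(\nu_1,\nu_2)$ is the set of real symmetric $d\times d$ matrices $(\alpha^{ij})$ with $\nu_1|\xi|^2\le\sum\alpha^{ij}\xi_i\xi_j\le\nu_2|\xi|^2$ for all $\xi\in\mathbb R^d$. For a distribution $F$, $F\le0$ means $\langle F,\zeta\rangle\le0$ for all $0\le\zeta\in C_c^\infty(\Omega)$. $\mathbf{ER}_\Omega$ is the set of all $(\delta,R)\in[0,1]\times\mathbb R_+$ such that for each $p\in\partial\Omega$ and each connected component $\Omega^{(i)}_{p,R}$ of $\Omega\cap B(p,R)$ there is a unit vector $e^{(i)}_{p,R}\in\mathbb R^d$ with $\Omega^{(i)}_{p,R}\subset\{x\in B_R(p):(x-p)\cdot e^{(i)}_{p,R}<\delta R\}$. $\delta_\Omega(R)$ is the infimum of $\delta$ such that $(\delta,R)\in\mathbf{ER}_\Omega$. For $\delta\in[0,1]$, $\Omega$ satisfies the totally $\delta$-exterior Reifenberg condition $\langle\mathrm{TER}_\delta\rangle$ if there exist $0<R_0\le R_\infty<\infty$ with $\delta_\Omega(R)\le\delta$ whenever $R\le R_0$ or $R\ge R_\infty$. *)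

theory Defs
  imports "HOL-Analysis.Analysis"
begin

definition elliptic_matrices :: "real \<Rightarrow> real \<Rightarrow> (real^'n^'n) set" where
  "elliptic_matrices \<nu>1 \<nu>2 =
     {A. transpose A = A \<and>
         (\<forall>\<xi>::real^'n.
            \<nu>1 * (norm \<xi>)\<^sup>2 \<le> (\<Sum>i\<in>UNIV. \<Sum>j\<in>UNIV. A $ i $ j * \<xi> $ i * \<xi> $ j) \<and>
            (\<Sum>i\<in>UNIV. \<Sum>j\<in>UNIV. A $ i $ j * \<xi> $ i * \<xi> $ j) \<le> \<nu>2 * (norm \<xi>)\<^sup>2)}"

definition domain :: "'a::topological_space set \<Rightarrow> bool" where
  "domain \<Omega> \<longleftrightarrow> open \<Omega> \<and> connected \<Omega> \<and> \<Omega> \<noteq> {}"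

definition exterior_Reifenberg :: "(real^'n) set \<Rightarrow> (real \<times> real) set" where
  "exterior_Reifenberg \<Omega> =
     {(\<delta>, R). 0 \<le> \<delta> \<and> \<delta> \<le> 1 \<and> 0 < R \<and>
        (\<forall>p\<in>frontier \<Omega>. \<forall>C\<in>components (\<Omega> \<inter> ball p R).
           \<exists>e. norm e = 1 \<and> C \<subseteq> {x \<in> ball p R. (x - p) \<bullet> e < \<delta> * R})}"

text \<open>The infimum below is over a nonempty set, as the pair \<open>(1, R)\<close> always qualifies.\<close>

lemma one_in_exterior_Reifenberg:
  fixes \<Omega> :: "(real^'n) set"
  assumes "0 < R"
  shows "(1, R) \<in> exterior_Reifenberg \<Omega>"
proof -
  obtain e :: "real^'n" where e: "norm e = 1"
    using vector_choose_size[of 1] by auto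
  have "C \<subseteq> {x \<in> ball p R. (x - p) \<bullet> e < 1 * R}"
    if "C \<in> components (\<Omega> \<inter> ball p R)" for p C
  proof
    fix x assume "x \<in> C"
    then have x: "x \<in> ball p R"
      using in_components_subset[OF that] by auto
    have "(x - p) \<bullet> e \<le> norm (x - p) * norm e"
      by (rule norm_cauchy_schwarz)
    also have "\<dots> < R"
      using x e by (simp add: dist_norm norm_minus_commute)
    finally show "x \<in> {x \<in> ball p R. (x - p) \<bullet> e < 1 * R}"
      using x by simp
  qed
  then have "\<exists>e. norm e = 1 \<and> C \<subseteq> {x \<in> ball p R. (x - p) \<bullet> e < 1 * R}"
    if "C \<in> components (\<Omega> \<inter> ball p R)" for p C
    using that e by blast
  then show ?thesis
    using assms by (simp add: exterior_Reifenberg_def)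
qed

definition delta_Reifenberg :: "(real^'n) set \<Rightarrow> real \<Rightarrow> real" where
  "delta_Reifenberg \<Omega> R = Inf {\<delta>. (\<delta>, R) \<in> exterior_Reifenberg \<Omega>}"

text \<open>The totally \<open>\<delta>\<close>-exterior Reifenberg condition asks for some \<open>R0\<close>, \<open>Rinf\<close> as below; they are
  kept as arguments because estimates depend on their ratio. Only \<open>\<delta> \<in> [0, 1]\<close> is meaningful:
  for \<open>\<delta> \<ge> 1\<close> the condition is void.\<close>

definition TER_with :: "real \<Rightarrow> real \<Rightarrow> real \<Rightarrow> (real^'n) set \<Rightarrow> bool" where
  "TER_with \<delta> R0 Rinf \<Omega> \<longleftrightarrow>
     0 < R0 \<and> R0 \<le> Rinf \<and>
     (\<forall>R>0. R \<le> R0 \<or> R \<ge> Rinf \<longrightarrow> delta_Reifenberg \<Omega> R \<le> \<delta>)"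

definition partial_deriv :: "'n \<Rightarrow> (real^'n \<Rightarrow> real) \<Rightarrow> real^'n \<Rightarrow> real" where
  "partial_deriv i f x = frechet_derivative f (at x) (axis i 1)"

primrec Ck :: "nat \<Rightarrow> (real^'n \<Rightarrow> real) \<Rightarrow> bool" where
  "Ck 0 f \<longleftrightarrow> continuous_on UNIV f"
| "Ck (Suc k) f \<longleftrightarrow> f differentiable_on UNIV \<and> (\<forall>i. Ck k (partial_deriv i f))"

definition test_functions :: "(real^'n) set \<Rightarrow> (real^'n \<Rightarrow> real) set" where
  "test_functions \<Omega> =
     {\<zeta>. (\<forall>k. Ck k \<zeta>) \<and> compact (closure {x. \<zeta> x \<noteq> 0}) \<and> closure {x. \<zeta> x \<noteq> 0} \<subseteq> \<Omega>}"

text \<open>Distributions are represented by their action on test functions; a locally integrable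
  function acts by integration, and derivatives act by duality.\<close>

type_synonym 'n distr = "(real^'n \<Rightarrow> real) \<Rightarrow> real"

definition locally_integrable_on :: "(real^'n \<Rightarrow> real) \<Rightarrow> (real^'n) set \<Rightarrow> bool" where
  "locally_integrable_on \<phi> \<Omega> \<longleftrightarrow>
     (\<forall>K. compact K \<and> K \<subseteq> \<Omega> \<longrightarrow> integrable (lebesgue_on K) \<phi>)"

definition distr_of :: "(real^'n::finite) set \<Rightarrow> (real^'n \<Rightarrow> real) \<Rightarrow> 'n distr" where
  "distr_of \<Omega> \<phi> \<zeta> = (LINT x|lebesgue_on \<Omega>. \<phi> x * \<zeta> x)"

definition distr_deriv :: "'n::finite \<Rightarrow> 'n distr \<Rightarrow> 'n distr" where
  "distr_deriv i F \<zeta> = - F (partial_deriv i \<zeta>)"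

definition distr_nonpos :: "(real^'n::finite) set \<Rightarrow> 'n distr \<Rightarrow> bool" where
  "distr_nonpos \<Omega> F \<longleftrightarrow> (\<forall>\<zeta>\<in>test_functions \<Omega>. (\<forall>x. 0 \<le> \<zeta> x) \<longrightarrow> F \<zeta> \<le> 0)"

definition second_order_distr ::
    "real^'n^'n \<Rightarrow> (real^'n) set \<Rightarrow> (real^'n \<Rightarrow> real) \<Rightarrow> 'n distr" where
  "second_order_distr A \<Omega> \<phi> \<zeta> =
     (\<Sum>i\<in>UNIV. \<Sum>j\<in>UNIV. A $ i $ j * distr_deriv i (distr_deriv j (distr_of \<Omega> \<phi>)) \<zeta>)"

end

theory Submission imports Defs begin

text \<open>
  Let \<open>\<beta> = 1 - \<epsilon>\<close>. On a component of \<open>\<Omega> \<inter> B(p, R)\<close> lying in \<open>{(x - p) \<bullet> e < \<delta> R}\<close>, an explicit quadratic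
  function of \<open>y = (x - p) / R\<close> is a positive supersolution for all \<open>A \<in> M(\<nu>\<^sup>2, 1)\<close>. It is at least of
  order \<open>\<kappa>\<close> for \<open>1/2 \<le> |y| < 1\<close> and at most \<open>4 r\<close> for \<open>|y| \<le> r\<close>, provided \<open>\<delta> \<le> r\<close>. Since \<open>\<beta> < 1\<close>,
  for small \<open>r\<close> the following holds when the radii grow by factors of at least \<open>1 / r\<close> and the weights of
  the barriers by factors \<open>r\<^sup>-\<^sup>\<beta>\<close>: near the boundary of its ball, each barrier exceeds the one of the next
  radius around the same point. Their pointwise infimum \<open>\<phi>\<close> is therefore never approached near the
  boundary of a ball, and inherits from quadratics an exact inequality between second differences:
  if \<open>A = \<Sum>\<^sub>k v\<^sub>k v\<^sub>k\<^sup>T\<close>, then \<open>\<Sum>\<^sub>k (\<phi>(x + h v\<^sub>k) + \<phi>(x - h v\<^sub>k) - 2 \<phi>(x)) \<le> 0\<close> for \<open>h\<close> small relative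
  to \<open>\<rho>(x)\<close>. Moving the differences onto a test function and letting \<open>h \<rightarrow> 0\<close> gives the distributional
  inequality.
\<close>

section \<open>Rank-one decomposition of elliptic matrices\<close>

text \<open>One step of the induction is a Schur complement: the row and column \<open>s\<close> are removed.\<close>

lemma psd_decomposition:
  fixes A :: "real^'n^'n"
  assumes "finite S" "transpose A = A" "\<And>\<xi>. 0 \<le> \<xi> \<bullet> (A *v \<xi>)"
    and "\<And>i j. i \<notin> S \<Longrightarrow> A $ i $ j = 0"
  shows "\<exists>v :: 'n \<Rightarrow> real^'n. \<forall>i j. A $ i $ j = (\<Sum>k\<in>S. v k $ i * v k $ j)"
  using assms
proof (induction S arbitrary: A rule: finite_induct)
  case empty
  then show ?case by simp
next
  case (insert s S)
  have sym: "A $ i $ j = A $ j $ i" for i j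
    using insert.prems(1) by (metis transpose_def vec_lambda_beta)
  define q where "q \<xi> = \<xi> \<bullet> (A *v \<xi>)" for \<xi>
  have q_ge: "0 \<le> q \<xi>" for \<xi>
    using insert.prems(2) by (simp add: q_def)
  define c where "c \<xi> = (\<Sum>j\<in>UNIV. A $ s $ j * \<xi> $ j)" for \<xi> :: "real^'n"
  \<comment> \<open>Along the direction of \<open>axis s 1\<close> the form is a quadratic
    polynomial in \<open>t\<close>. Its nonnegativity at suitable \<open>t\<close> yields every
    positivity fact below.\<close>
  have expand: "q (\<xi> + t *\<^sub>R axis s 1) = q \<xi> + 2 * t * c \<xi> + t\<^sup>2 * A $ s $ s" for \<xi> t
  proof -
    have 1: "axis s 1 \<bullet> (A *v \<xi>) = c \<xi>" for \<xi>
      by (simp add: inner_axis' matrix_vector_mult_def c_def)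
    have 2: "\<xi> \<bullet> (A *v axis s 1) = c \<xi>" for \<xi>
      using insert.prems(1) by (metis 1 dot_lmul_matrix inner_commute transpose_matrix_vector)
    have 3: "c (axis s 1) = A $ s $ s"
      by (simp add: c_def axis_def if_distrib cong: if_cong)
    have "c (\<xi> + t *\<^sub>R axis s 1) = c \<xi> + t * c (axis s 1)"
      by (simp add: c_def sum.distrib sum_distrib_left algebra_simps)
    with 1 2 3 show ?thesis
      by (simp add: q_def matrix_vector_right_distrib matrix_vector_mult_scaleR inner_add_left inner_add_right
          power2_eq_square algebra_simps)
  qed
  \<comment> \<open>The rank-one part to split off. If the pivot vanishes, so does its whole row
    (\<open>row0\<close>), and nothing has to be removed.\<close>
  define u where "u = (if A $ s $ s = 0 then 0 else (\<chi> i. A $ s $ i / sqrt (A $ s $ s)))"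
  define B where "B = (\<chi> i j. A $ i $ j - u $ i * u $ j)"
  have Ass: "0 \<le> A $ s $ s"
    using q_ge[of "0 + 1 *\<^sub>R axis s 1"] unfolding expand by (simp add: q_def c_def)
  have row0: "A $ s $ j = 0" if "A $ s $ s = 0" for j
  proof (rule ccontr)
    assume n: "A $ s $ j \<noteq> 0"
    have c: "c (axis j 1) = A $ s $ j"
      by (simp add: c_def axis_def if_distrib cong: if_cong)
    \<comment> \<open>With a zero pivot the form is affine in \<open>t\<close> with slope
      \<open>2 * A $ s $ j\<close>; this \<open>t\<close> makes its value exactly -1.\<close>
    define t where "t = - (q (axis j 1) + 1) / (2 * A $ s $ j)"
    have "q (axis j 1 + t *\<^sub>R axis s 1) = -1"
      using n unfolding expand c by (simp add: that t_def field_simps)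
    then show False using q_ge by (metis neg_0_le_iff_le not_one_le_zero)
  qed
  have uu: "u $ i * u $ j = (if A $ s $ s = 0 then 0 else A $ s $ i * A $ s $ j / A $ s $ s)" for i j
    using Ass by (simp add: u_def)
  have "\<exists>v :: 'n \<Rightarrow> real^'n. \<forall>i j. B $ i $ j = (\<Sum>k\<in>S. v k $ i * v k $ j)"
  proof (rule insert.IH)
    show "transpose B = B"
      by (simp add: B_def transpose_def vec_eq_iff sym mult.commute)
    show "B $ i $ j = 0" if "i \<notin> S" for i j
      using that insert.prems(3)[of i] row0 sym[of s i] by (cases "i = s") (auto simp: B_def uu)
    show "0 \<le> \<xi> \<bullet> (B *v \<xi>)" for \<xi>
    proof -
      have "\<xi> \<bullet> (B *v \<xi>) = q \<xi> - (\<Sum>i\<in>UNIV. u $ i * \<xi> $ i)\<^sup>2"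
        by (simp add: q_def B_def inner_vec_def matrix_vector_mult_def sum_subtractf sum_distrib_left
            sum_distrib_right power2_eq_square sum_product algebra_simps)
      also have "(\<Sum>i\<in>UNIV. u $ i * \<xi> $ i)\<^sup>2 = (if A $ s $ s = 0 then 0 else (c \<xi>)\<^sup>2 / A $ s $ s)"
        using Ass by (simp add: u_def c_def power_divide flip: sum_divide_distrib)
      \<comment> \<open>Completing the square: the reduced form at \<open>\<xi>\<close> is the value
        of \<open>q\<close> at its minimum along the line in direction \<open>axis s 1\<close>,
        hence nonnegative.\<close>
      also have "q \<xi> - \<dots> = (if A $ s $ s = 0 then q \<xi>
          else q (\<xi> + (- c \<xi> / A $ s $ s) *\<^sub>R axis s 1))"
        unfolding expand by (simp add: power2_eq_square field_simps)
      finally show ?thesis using q_ge by (simp split: if_splits)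
    qed
  qed
  then obtain v :: "'n \<Rightarrow> real^'n" where v: "\<And>i j. B $ i $ j = (\<Sum>k\<in>S. v k $ i * v k $ j)"
    by blast
  have "A $ i $ j = (\<Sum>k\<in>insert s S. (v(s := u)) k $ i * (v(s := u)) k $ j)" for i j
  proof -
    have "(\<Sum>k\<in>S. (v(s := u)) k $ i * (v(s := u)) k $ j) = B $ i $ j"
      unfolding v using insert.hyps by (intro sum.cong) auto
    then show ?thesis using insert.hyps by (simp add: B_def)
  qed
  then show ?case by blast
qed

text \<open>The sum of \<open>(v k \<bullet> e)\<^sup>2\<close> is the quadratic form at
  \<open>e\<close>, so ellipticity bounds it from below. The sum of squared norms is the trace,
  whose entries are values of the form at unit vectors and so at most 1.\<close>

lemma elliptic_decomposition:
  fixes A :: "real^'n^'n"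
  assumes A: "A \<in> elliptic_matrices \<mu> 1" and "0 \<le> \<mu>"
  obtains v :: "'n \<Rightarrow> real^'n"
  where "\<And>i j. A $ i $ j = (\<Sum>k\<in>UNIV. v k $ i * v k $ j)"
    "\<And>e. norm e = 1 \<Longrightarrow> \<mu> \<le> (\<Sum>k\<in>UNIV. (v k \<bullet> e)\<^sup>2)"
    "(\<Sum>k\<in>UNIV. (norm (v k))\<^sup>2) \<le> real CARD('n)"
proof -
  define q where "q \<xi> = (\<Sum>i\<in>UNIV. \<Sum>j\<in>UNIV. A $ i $ j * \<xi> $ i * \<xi> $ j)" for \<xi>
  have T: "transpose A = A" and q: "\<mu> * (norm \<xi>)\<^sup>2 \<le> q \<xi>" "q \<xi> \<le> (norm \<xi>)\<^sup>2" for \<xi>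
    using A by (auto simp: elliptic_matrices_def q_def)
  have q_inner: "q \<xi> = \<xi> \<bullet> (A *v \<xi>)" for \<xi>
    by (simp add: q_def inner_vec_def matrix_vector_mult_def sum_distrib_left mult_ac)
  have "0 \<le> \<xi> \<bullet> (A *v \<xi>)" for \<xi>
    using q(1)[of \<xi>] \<open>0 \<le> \<mu>\<close> unfolding q_inner
    by (metis mult_nonneg_nonneg order_trans zero_le_power2)
  then obtain v :: "'n \<Rightarrow> real^'n" where v: "\<And>i j. A $ i $ j = (\<Sum>k\<in>UNIV. v k $ i * v k $ j)"
    using psd_decomposition[of UNIV A] T by auto
  have "(\<Sum>k\<in>UNIV. (v k \<bullet> e)\<^sup>2) = q e" for e
  proof -
    have "(\<Sum>k\<in>UNIV. (v k \<bullet> e)\<^sup>2)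
        = (\<Sum>k\<in>UNIV. \<Sum>i\<in>UNIV. \<Sum>j\<in>UNIV. v k $ i * v k $ j * e $ i * e $ j)"
      by (simp add: inner_vec_def power2_eq_square sum_product mult_ac)
    also have "\<dots> = (\<Sum>i\<in>UNIV. \<Sum>j\<in>UNIV. \<Sum>k\<in>UNIV. v k $ i * v k $ j * e $ i * e $ j)"
      by (subst sum.swap, rule sum.cong[OF refl], rule sum.swap)
    also have "\<dots> = q e"
      by (simp add: q_def v sum_distrib_right)
    finally show ?thesis .
  qed
  then have 1: "\<mu> \<le> (\<Sum>k\<in>UNIV. (v k \<bullet> e)\<^sup>2)" if "norm e = 1" for e
    using q(1)[of e] that by simp
  have "A $ i $ i \<le> 1" for i
  proof -
    have "q (axis i 1) = A $ i $ i"
      by (simp add: q_inner inner_axis' matrix_vector_mult_basis column_def)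
    then show ?thesis using q(2)[of "axis i 1"] by simp
  qed
  then have "(\<Sum>i\<in>UNIV. A $ i $ i) \<le> real CARD('n)"
    using sum_bounded_above[of UNIV "\<lambda>i. A $ i $ i" 1] by simp
  moreover have "(\<Sum>k\<in>UNIV. (norm (v k))\<^sup>2) = (\<Sum>i\<in>UNIV. A $ i $ i)"
    unfolding v power2_norm_eq_inner inner_vec_def inner_real_def by (rule sum.swap)
  ultimately show ?thesis using that[OF v 1] by simp
qed

section \<open>Second differences and distributions\<close>

lemma has_field_derivative_along_line:
  fixes f :: "real^'n \<Rightarrow> real"
  assumes "f differentiable_on UNIV"
  shows "((\<lambda>t. f (x + t *\<^sub>R v)) has_real_derivative
      (\<Sum>i\<in>UNIV. v $ i * partial_deriv i f (x + t *\<^sub>R v))) (at t)"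
proof -
  let ?D = "frechet_derivative f (at (x + t *\<^sub>R v))"
  have d: "(f has_derivative ?D) (at (x + t *\<^sub>R v))"
    using assms by (simp add: differentiable_on_def frechet_derivative_works)
  have l: "linear ?D"
    using d has_derivative_linear by blast
  have "((\<lambda>t. x + t *\<^sub>R v) has_derivative (\<lambda>s. s *\<^sub>R v)) (at t)"
    by (auto intro!: derivative_eq_intros)
  from diff_chain_at[OF this d]
  have "((\<lambda>t. f (x + t *\<^sub>R v)) has_derivative (\<lambda>s. ?D (s *\<^sub>R v))) (at t)"
    by (simp add: o_def)
  moreover have "?D (s *\<^sub>R v) = (\<Sum>i\<in>UNIV. v $ i * partial_deriv i f (x + t *\<^sub>R v)) * s" for s
  proof -
    have "?D v = ?D (\<Sum>i\<in>UNIV. v $ i *\<^sub>R axis i 1)"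
      by (subst basis_expansion[of v, symmetric]) (simp add: scalar_mult_eq_scaleR)
    also have "\<dots> = (\<Sum>i\<in>UNIV. v $ i * partial_deriv i f (x + t *\<^sub>R v))"
      by (simp add: linear_sum[OF l] linear_scale[OF l] partial_deriv_def)
    finally show ?thesis
      by (simp add: linear_scale[OF l])
  qed
  ultimately show ?thesis
    by (simp add: has_field_derivative_def)
qed

text \<open>The second derivative in direction \<open>v\<close>. The partial derivatives come in the
  order in which two distributional derivatives act on a test function.\<close>

definition hessian_form :: "(real^'n \<Rightarrow> real) \<Rightarrow> real^'n \<Rightarrow> real^'n \<Rightarrow> real" where
  "hessian_form f v x = (\<Sum>i\<in>UNIV. \<Sum>j\<in>UNIV. v $ i * v $ j * partial_deriv j (partial_deriv i f) x)"

text \<open>Maclaurin's formula of order 2 is applied to the sum of the restrictions of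
  \<open>f\<close> to the rays along \<open>v\<close> and \<open>-v\<close>, whose first derivatives
  at 0 cancel. Treating the sum as one function gives a common \<open>\<theta>\<close>.\<close>

lemma second_difference_eq:
  fixes f :: "real^'n \<Rightarrow> real"
  assumes "Ck 2 f" "0 < h"
  obtains \<theta> where "0 < \<theta>" "\<theta> < h"
    "f (x + h *\<^sub>R v) + f (x - h *\<^sub>R v) - 2 * f x
      = h\<^sup>2 / 2 * (hessian_form f v (x + \<theta> *\<^sub>R v) + hessian_form f v (x - \<theta> *\<^sub>R v))"
proof -
  have d: "f differentiable_on UNIV" "\<And>i. partial_deriv i f differentiable_on UNIV"
    using assms(1) by (simp_all add: numeral_2_eq_2)
  define G where "G u t = f (x + t *\<^sub>R u)" for u t
  define G1 where "G1 u t = (\<Sum>i\<in>UNIV. u $ i * partial_deriv i f (x + t *\<^sub>R u))" for u t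
  have G: "(G u has_real_derivative G1 u t) (at t)" for u t
    unfolding G_def G1_def by (rule has_field_derivative_along_line[OF d(1)])
  have m: "hessian_form f (-v) y = hessian_form f v y" for y
    by (simp add: hessian_form_def)
  have G1: "(G1 u has_real_derivative hessian_form f u (x + t *\<^sub>R u)) (at t)" for u t
    unfolding G1_def hessian_form_def
    by (rule derivative_eq_intros has_field_derivative_along_line[OF d(2)] refl)+
       (simp add: sum_distrib_left algebra_simps)
  \<comment> \<open>The sequence of derivatives for Maclaurin's formula; only the indices 0, 1 and 2
    occur in it.\<close>
  define D where "D m = (if m = 0 then \<lambda>t. G v t + G (-v) t else if m = Suc 0 then \<lambda>t. G1 v t + G1 (-v) t
     else (\<lambda>t. hessian_form f v (x + t *\<^sub>R v) + hessian_form f v (x - t *\<^sub>R v)))" for m :: nat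
  have "\<exists>\<theta>. 0 < \<theta> \<and> \<theta> < h \<and> D 0 h =
      (\<Sum>m<2. D m 0 / fact m * h ^ m) + D 2 \<theta> / fact 2 * h ^ 2"
  proof (rule Maclaurin[OF assms(2)])
    show "\<forall>m t. m < 2 \<and> 0 \<le> t \<and> t \<le> h \<longrightarrow> (D m has_real_derivative D (Suc m) t) (at t)"
      using G1[of "-v"] by (auto simp: D_def less_2_cases_iff m intro!: DERIV_add G G1)
  qed auto
  then obtain \<theta> where th: "0 < \<theta>" "\<theta> < h" and
    e: "D 0 h = (\<Sum>m<2. D m 0 / fact m * h ^ m) + D 2 \<theta> / fact 2 * h ^ 2"
    by blast
  have "G1 (-v) 0 = - G1 v 0"
    by (simp add: G1_def sum_negf)
  with e that[OF th] show ?thesis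
    by (simp add: D_def numeral_2_eq_2 G_def m algebra_simps)
qed

lemma continuous_on_hessian_form:
  assumes "Ck 2 f"
  shows "continuous_on UNIV (hessian_form f v)"
  using assms unfolding hessian_form_def[abs_def]
  by (auto simp: numeral_2_eq_2 intro!: continuous_intros)

lemma partial_deriv_eq_0:
  assumes "closed K" "\<And>x. x \<notin> K \<Longrightarrow> f x = 0" "x \<notin> K"
  shows "partial_deriv i f x = 0"
proof -
  have "(f has_derivative (\<lambda>_. 0)) (at x)"
    by (rule has_derivative_transform_within_open[where f = "\<lambda>_. 0" and s = "- K"]) (use assms in auto)
  from frechet_derivative_at[OF this] show ?thesis
    by (simp add: partial_deriv_def fun_eq_iff)
qed

section \<open>Integrals against bounded continuous functions and translation invariance\<close>

lemma bounded_if_compact_support: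
  fixes g :: "'a::metric_space \<Rightarrow> real"
  assumes "continuous_on UNIV g" "compact K" "\<And>x. x \<notin> K \<Longrightarrow> g x = 0"
  obtains B where "\<And>x. \<bar>g x\<bar> \<le> B"
proof -
  have "bounded (g ` K)"
    using assms by (intro compact_imp_bounded compact_continuous_image continuous_on_subset[OF assms(1)]) auto
  then obtain B where B: "\<And>x. x \<in> K \<Longrightarrow> \<bar>g x\<bar> \<le> B"
    by (auto simp: bounded_iff)
  have "\<bar>g x\<bar> \<le> max B 0" for x
    using B[of x] assms(3)[of x] by (cases "x \<in> K") auto
  with that show ?thesis by blast
qed

lemma integrable_lebesgue_mult_bounded_continuous:
  fixes \<psi> g :: "'a::euclidean_space \<Rightarrow> real"
  assumes \<psi>: "integrable lebesgue \<psi>" and g: "continuous_on UNIV g" and B: "\<And>x. \<bar>g x\<bar> \<le> B"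
  shows "integrable lebesgue (\<lambda>x. \<psi> x * g x)"
proof (rule Bochner_Integration.integrable_bound)
  show "integrable lebesgue (\<lambda>x. B * \<psi> x)" using \<psi> by simp
  have "g \<in> borel_measurable lebesgue"
    by (intro measurable_completion) (simp add: g borel_measurable_continuous_onI)
  with \<psi> show "(\<lambda>x. \<psi> x * g x) \<in> borel_measurable lebesgue" by measurable
  have "\<bar>\<psi> x * g x\<bar> \<le> \<bar>B * \<psi> x\<bar>" for x
    using mult_right_mono[OF order_trans[OF B[of x] abs_ge_self[of B]], of "\<bar>\<psi> x\<bar>"]
    by (simp add: abs_mult mult.commute)
  then show "AE x in lebesgue. norm (\<psi> x * g x) \<le> norm (B * \<psi> x)" by simp
qed

lemma lebesgue_distr_plus:
  fixes c :: "'a::euclidean_space"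
  shows "distr lebesgue lebesgue ((+) c) = lebesgue"
    and "(+) c \<in> lebesgue \<rightarrow>\<^sub>M lebesgue"
proof -
  \<comment> \<open>A translation is the affine map with all scaling factors 1, so the density in
    the affine change of variables is 1.\<close>
  have "lebesgue = density (distr lebesgue lebesgue ((+) c)) (\<lambda>_. 1)"
    using lebesgue_affine_euclidean[of "\<lambda>_. 1" c] by (simp add: euclidean_representation)
  then show "distr lebesgue lebesgue ((+) c) = lebesgue"
    by (simp add: density_1)
  show "(+) c \<in> lebesgue \<rightarrow>\<^sub>M lebesgue"
    using lebesgue_affine_measurable[of "\<lambda>_. 1" c] by (simp add: euclidean_representation)
qed

lemma lebesgue_integral_translation:
  fixes f :: "'a::euclidean_space \<Rightarrow> real"
  assumes "integrable lebesgue f"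
  shows "integrable lebesgue (\<lambda>x. f (c + x))" "(LINT x|lebesgue. f (c + x)) = (LINT x|lebesgue. f x)"
proof -
  show "integrable lebesgue (\<lambda>x. f (c + x))"
    using assms integrable_distr[OF lebesgue_distr_plus(2)[of c], where f = f]
    by (simp add: lebesgue_distr_plus(1))
  show "(LINT x|lebesgue. f (c + x)) = (LINT x|lebesgue. f x)"
    using integral_distr[OF lebesgue_distr_plus(2)[of c], of f] assms
    by (simp add: lebesgue_distr_plus(1))
qed

text \<open>The intermediate point \<open>\<theta> h\<close> is squeezed between 0 and
  \<open>h\<close>, so continuity of the Hessian form gives the limit.\<close>

lemma second_difference_tendsto:
  fixes f :: "real^'n \<Rightarrow> real"
  assumes "Ck 2 f"
  shows "((\<lambda>h. (f (x + h *\<^sub>R v) + f (x - h *\<^sub>R v) - 2 * f x) / h\<^sup>2) \<longlongrightarrow> hessian_form f v x) (at_right 0)"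
proof -
  have "\<exists>\<theta>. 0 < \<theta> \<and> \<theta> < h \<and> (f (x + h *\<^sub>R v) + f (x - h *\<^sub>R v) - 2 * f x) / h\<^sup>2
      = (hessian_form f v (x + \<theta> *\<^sub>R v) + hessian_form f v (x - \<theta> *\<^sub>R v)) / 2" if h: "0 < h" for h
    by (rule second_difference_eq[OF assms h, of x v]) (use h in \<open>auto intro!: exI simp: field_simps\<close>)
  then obtain \<theta> where \<theta>: "\<And>h. 0 < h \<Longrightarrow> 0 < \<theta> h \<and> \<theta> h < h \<and>
      (f (x + h *\<^sub>R v) + f (x - h *\<^sub>R v) - 2 * f x) / h\<^sup>2
      = (hessian_form f v (x + \<theta> h *\<^sub>R v) + hessian_form f v (x - \<theta> h *\<^sub>R v)) / 2"
    by metis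
  have ev: "eventually (\<lambda>h::real. 0 < h) (at_right 0)"
    by (simp add: eventually_at_right_less)
  have "eventually (\<lambda>h. 0 \<le> \<theta> h) (at_right 0)" "eventually (\<lambda>h. \<theta> h \<le> h) (at_right 0)"
    using ev by (eventually_elim, use \<theta> in fastforce)+
  then have "(\<theta> \<longlongrightarrow> 0) (at_right 0)"
    by (rule tendsto_sandwich[OF _ _ tendsto_const tendsto_ident_at])
  moreover have "isCont (hessian_form f v) y" for y
    using continuous_on_hessian_form[OF assms] by (simp add: continuous_on_eq_continuous_at)
  ultimately have "((\<lambda>h. (hessian_form f v (x + \<theta> h *\<^sub>R v) + hessian_form f v (x - \<theta> h *\<^sub>R v)) / 2)
      \<longlongrightarrow> (hessian_form f v (x + 0 *\<^sub>R v) + hessian_form f v (x - 0 *\<^sub>R v)) / 2) (at_right 0)"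
    by (intro tendsto_intros isCont_tendsto_compose[of _ "hessian_form f v"]) auto
  moreover have "eventually (\<lambda>h. (hessian_form f v (x + \<theta> h *\<^sub>R v) + hessian_form f v (x - \<theta> h *\<^sub>R v)) / 2
      = (f (x + h *\<^sub>R v) + f (x - h *\<^sub>R v) - 2 * f x) / h\<^sup>2) (at_right 0)"
    using ev by eventually_elim (use \<theta> in presburger)
  ultimately show ?thesis
    using Lim_transform_eventually by fastforce
qed

text \<open>A discrete integration by parts: translation invariance moves the second differences of
  \<open>\<zeta>\<close> onto \<open>\<phi>\<close>, where they sum to something nonpositive. The
  difference quotients of \<open>\<zeta>\<close> converge boundedly to the Hessian forms, whose sum
  is the operator with matrix \<open>A\<close>.\<close>

lemma distr_nonpos_if_second_differences_nonpos:
  fixes \<phi> :: "real^'n \<Rightarrow> real" and v :: "'k \<Rightarrow> real^'n"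
  assumes fin: "finite S" and \<Omega>: "open \<Omega>" and loc: "locally_integrable_on \<phi> \<Omega>"
    and A: "\<And>i j. A $ i $ j = (\<Sum>k\<in>S. v k $ i * v k $ j)"
    and sd: "\<And>K. compact K \<Longrightarrow> K \<subseteq> \<Omega> \<Longrightarrow> \<exists>h0>0. \<forall>h x. 0 < h \<and> h < h0 \<and> x \<in> K \<longrightarrow>
      (\<Sum>k\<in>S. \<phi> (x + h *\<^sub>R v k) + \<phi> (x - h *\<^sub>R v k) - 2 * \<phi> x) \<le> 0"
  shows "distr_nonpos \<Omega> (second_order_distr A \<Omega> \<phi>)"
  unfolding distr_nonpos_def
proof (intro ballI impI)
  fix \<zeta> :: "real^'n \<Rightarrow> real"
  assume "\<zeta> \<in> test_functions \<Omega>" and \<zeta>0: "\<forall>x. 0 \<le> \<zeta> x"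
  then have Ck: "Ck k \<zeta>" and cK: "compact (closure {x. \<zeta> x \<noteq> 0})"
    and K_sub: "closure {x. \<zeta> x \<noteq> 0} \<subseteq> \<Omega>" for k
    by (auto simp: test_functions_def)
  define K where "K = closure {x. \<zeta> x \<noteq> 0}"
  have K: "compact K" "closed K" "K \<subseteq> \<Omega>" using cK K_sub by (simp_all add: K_def)
  have \<zeta>K: "\<zeta> x = 0" if "x \<notin> K" for x
    using that closure_subset[of "{x. \<zeta> x \<noteq> 0}"] by (auto simp: K_def)
  have dK: "partial_deriv i \<zeta> x = 0" if "x \<notin> K" for i x
    using partial_deriv_eq_0[OF K(2) \<zeta>K that] .
  have ddK: "partial_deriv j (partial_deriv i \<zeta>) x = 0" if "x \<notin> K" for i j x
    using partial_deriv_eq_0[OF K(2) dK that] .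
  have hK: "hessian_form \<zeta> u x = 0" if "x \<notin> K" for u x
    using ddK[OF that] by (simp add: hessian_form_def)
  have cont: "continuous_on UNIV \<zeta>" using Ck[of 0] by simp
  have cont2: "continuous_on UNIV (partial_deriv j (partial_deriv i \<zeta>))" for i j
    using Ck[of "Suc (Suc 0)"] by simp
  obtain a where a: "0 < a" "(\<Union>x\<in>K. cball x a) \<subseteq> \<Omega>"
    using compact_subset_open_imp_cball_epsilon_subset[OF K(1) \<Omega> K(3)] by blast
  \<comment> \<open>A compact neighbourhood of the support that contains all shifted points for
    small \<open>h\<close>. Cutting \<open>\<phi>\<close> off outside it gives a function
    \<open>\<psi>\<close> integrable on the whole space, which can be translated freely.\<close>
  define K' where "K' = (\<Union>x\<in>K. cball x a)"
  have K': "compact K'" "K' \<subseteq> \<Omega>"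
    using compact_minkowski_sum_cball[OF K(1)] a by (simp_all add: K'_def)
  have KK': "y \<in> K'" if "x \<in> K" "norm (y - x) \<le> a" for x y
    using that by (auto simp: K'_def dist_norm norm_minus_commute)
  then have "K \<subseteq> K'" using a by fastforce
  define \<psi> where "\<psi> x = indicator K' x * \<phi> x" for x
  have \<psi>: "integrable lebesgue \<psi>"
    using loc K' integrable_restrict_space[of K' lebesgue \<phi>]
    by (simp add: locally_integrable_on_def \<psi>_def[abs_def] borel_compact)
  have int: "(LINT x|lebesgue_on \<Omega>. \<phi> x * g x) = (LINT x|lebesgue. \<psi> x * g x)"
    if "\<And>x. x \<notin> K \<Longrightarrow> g x = 0" for g
  proof -
    have "(LINT x|lebesgue_on \<Omega>. \<phi> x * g x) = (LINT x|lebesgue. indicator \<Omega> x *\<^sub>R (\<phi> x * g x))"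
      using \<Omega> by (intro integral_restrict_space) simp
    also have "\<dots> = (LINT x|lebesgue. \<psi> x * g x)"
      using that K' \<open>K \<subseteq> K'\<close> K by (intro Bochner_Integration.integral_cong) (auto simp: \<psi>_def indicator_def)
    finally show ?thesis .
  qed
  have bounded_int: "integrable lebesgue (\<lambda>x. \<psi> x * g x)"
    if g: "continuous_on UNIV g" "\<And>x. x \<notin> K \<Longrightarrow> g x = 0" for g
    using bounded_if_compact_support[OF g(1) K(1) g(2)] integrable_lebesgue_mult_bounded_continuous[OF \<psi> g(1)]
    by metis
  \<comment> \<open>The minus signs of the two distributional derivatives cancel.\<close>
  have "second_order_distr A \<Omega> \<phi> \<zeta>
      = (\<Sum>i\<in>UNIV. \<Sum>j\<in>UNIV. A $ i $ j * (LINT x|lebesgue. \<psi> x * partial_deriv j (partial_deriv i \<zeta>) x))"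
    by (simp add: second_order_distr_def distr_deriv_def distr_of_def int ddK)
  also have "\<dots> = (LINT x|lebesgue. (\<Sum>i\<in>UNIV. \<Sum>j\<in>UNIV. A $ i $ j * (\<psi> x * partial_deriv j (partial_deriv i \<zeta>) x)))"
    using bounded_int[OF cont2 ddK] by simp
  also have "\<dots> = (LINT x|lebesgue. \<psi> x * (\<Sum>k\<in>S. hessian_form \<zeta> (v k) x))"
  proof (intro Bochner_Integration.integral_cong refl)
    fix x
    have "(\<Sum>k\<in>S. hessian_form \<zeta> (v k) x)
        = (\<Sum>i\<in>UNIV. \<Sum>j\<in>UNIV. A $ i $ j * partial_deriv j (partial_deriv i \<zeta>) x)"
      unfolding hessian_form_def A sum_distrib_right
      by (subst sum.swap, rule sum.cong[OF refl], rule sum.swap)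
    then show "(\<Sum>i\<in>UNIV. \<Sum>j\<in>UNIV. A $ i $ j * (\<psi> x * partial_deriv j (partial_deriv i \<zeta>) x))
        = \<psi> x * (\<Sum>k\<in>S. hessian_form \<zeta> (v k) x)"
      by (simp add: sum_distrib_left algebra_simps)
  qed
  also have "\<dots> \<le> 0"
  proof -
    define q where "q h x = (\<Sum>k\<in>S. (\<zeta> (x + h *\<^sub>R v k) + \<zeta> (x - h *\<^sub>R v k) - 2 * \<zeta> x) / h\<^sup>2)" for h x
    have C2: "Ck 2 \<zeta>" by (rule Ck)
    have "\<exists>B. \<forall>x. \<bar>hessian_form \<zeta> u x\<bar> \<le> B" for u
      using bounded_if_compact_support[OF continuous_on_hessian_form[OF C2] K(1) hK] by metis
    then obtain B where B: "\<And>u x. \<bar>hessian_form \<zeta> u x\<bar> \<le> B u" by metis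
    have half: "\<bar>(a + b) / 2\<bar> \<le> c" if "\<bar>a\<bar> \<le> c" "\<bar>b\<bar> \<le> c" for a b c :: real
    proof -
      have "\<bar>a + b\<bar> \<le> 2 * c" using that by linarith
      then show ?thesis by simp
    qed
    \<comment> \<open>A bound uniform in \<open>h\<close> and \<open>x\<close>; multiplied by
      \<open>\<bar>\<psi> x\<bar>\<close> it dominates the integrands in the passage to the
      limit.\<close>
    have q_bound: "\<bar>q h x\<bar> \<le> (\<Sum>k\<in>S. B (v k))" if h: "0 < h" for h x
      unfolding q_def
    proof (rule order_trans[OF sum_abs sum_mono])
      fix k
      obtain \<theta> where "\<zeta> (x + h *\<^sub>R v k) + \<zeta> (x - h *\<^sub>R v k) - 2 * \<zeta> x
          = h\<^sup>2 / 2 * (hessian_form \<zeta> (v k) (x + \<theta> *\<^sub>R v k) + hessian_form \<zeta> (v k) (x - \<theta> *\<^sub>R v k))"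
        using second_difference_eq[OF C2 h] .
      then have eq: "(\<zeta> (x + h *\<^sub>R v k) + \<zeta> (x - h *\<^sub>R v k) - 2 * \<zeta> x) / h\<^sup>2
          = (hessian_form \<zeta> (v k) (x + \<theta> *\<^sub>R v k) + hessian_form \<zeta> (v k) (x - \<theta> *\<^sub>R v k)) / 2"
        using h by (simp add: field_simps)
      then show "\<bar>(\<zeta> (x + h *\<^sub>R v k) + \<zeta> (x - h *\<^sub>R v k) - 2 * \<zeta> x) / h\<^sup>2\<bar> \<le> B (v k)"
        unfolding eq by (intro half B)
    qed
    have cont_q: "continuous_on UNIV (q h)" if "0 < h" for h
      unfolding q_def[abs_def] using that
      by (intro continuous_intros continuous_on_compose2[OF cont]) auto
    obtain h0 where h0: "0 < h0" and sd_K: "\<And>h x. 0 < h \<Longrightarrow> h < h0 \<Longrightarrow> x \<in> K \<Longrightarrow>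
        (\<Sum>k\<in>S. \<phi> (x + h *\<^sub>R v k) + \<phi> (x - h *\<^sub>R v k) - 2 * \<phi> x) \<le> 0"
      using sd[OF K(1,3)] by blast
    have le0: "(LINT x|lebesgue. \<psi> x * q h x) \<le> 0"
      if h: "0 < h" "h < h0" and ha: "\<And>k. k \<in> S \<Longrightarrow> h * norm (v k) \<le> a" for h
    proof -
      obtain Bz where Bz: "\<And>x. \<bar>\<zeta> x\<bar> \<le> Bz"
        using bounded_if_compact_support[OF cont K(1) \<zeta>K] by metis
      have i: "integrable lebesgue (\<lambda>x. \<psi> x * \<zeta> (x + y))" for y
        by (intro integrable_lebesgue_mult_bounded_continuous[OF \<psi>, of _ Bz] continuous_on_compose2[OF cont]
            continuous_intros Bz) auto
      have shift: "integrable lebesgue (\<lambda>x. \<psi> (x - y) * \<zeta> x)"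
        "(LINT x|lebesgue. \<psi> x * \<zeta> (x + y)) = (LINT x|lebesgue. \<psi> (x - y) * \<zeta> x)" for y
        using lebesgue_integral_translation[OF i[of y], of "-y"] by simp_all
      \<comment> \<open>The arguments \<open>x + (- h) *\<^sub>R v k\<close> and
        \<open>x + 0\<close> are kept unsimplified, so that the one translation rule
        \<open>shift\<close> fits all three integrals.\<close>
      have "(LINT x|lebesgue. \<psi> x * q h x) = (LINT x|lebesgue. (\<Sum>k\<in>S. \<psi> x * \<zeta> (x + h *\<^sub>R v k)
          + \<psi> x * \<zeta> (x + (- h) *\<^sub>R v k) - 2 * (\<psi> x * \<zeta> (x + 0))) / h\<^sup>2)"
        by (intro Bochner_Integration.integral_cong)
           (simp_all add: q_def sum_distrib_left sum_divide_distrib algebra_simps diff_divide_distrib add_divide_distrib)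
      also have "\<dots> = (\<Sum>k\<in>S. (LINT x|lebesgue. \<psi> x * \<zeta> (x + h *\<^sub>R v k))
          + (LINT x|lebesgue. \<psi> x * \<zeta> (x + (- h) *\<^sub>R v k)) - 2 * (LINT x|lebesgue. \<psi> x * \<zeta> (x + 0))) / h\<^sup>2"
        using i by (simp del: add_0_right scaleR_minus_left)
      also have "\<dots> = (\<Sum>k\<in>S. (LINT x|lebesgue. \<psi> (x - h *\<^sub>R v k) * \<zeta> x)
          + (LINT x|lebesgue. \<psi> (x - (- h) *\<^sub>R v k) * \<zeta> x) - 2 * (LINT x|lebesgue. \<psi> (x - 0) * \<zeta> x)) / h\<^sup>2"
        unfolding shift(2) ..
      also have "\<dots> = (LINT x|lebesgue. (\<Sum>k\<in>S. \<psi> (x - h *\<^sub>R v k) * \<zeta> x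
          + \<psi> (x - (- h) *\<^sub>R v k) * \<zeta> x - 2 * (\<psi> (x - 0) * \<zeta> x)) / h\<^sup>2)"
        using shift(1) shift(1)[of 0] by (simp del: diff_0_right scaleR_minus_left)
      \<comment> \<open>Two sign changes reduce the claim to the integral of a nonnegative
        function.\<close>
      also have "\<dots> = - (LINT x|lebesgue. - ((\<Sum>k\<in>S. \<psi> (x - h *\<^sub>R v k) * \<zeta> x
          + \<psi> (x - (- h) *\<^sub>R v k) * \<zeta> x - 2 * (\<psi> (x - 0) * \<zeta> x)) / h\<^sup>2))"
        by (subst Bochner_Integration.integral_minus) simp
      also have "\<dots> \<le> 0"
        unfolding neg_le_0_iff_le
      proof (rule Bochner_Integration.integral_nonneg)
        fix x
        have "(\<Sum>k\<in>S. \<psi> (x - h *\<^sub>R v k) * \<zeta> x + \<psi> (x - (- h) *\<^sub>R v k) * \<zeta> x - 2 * (\<psi> (x - 0) * \<zeta> x)) \<le> 0"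
        proof (cases "x \<in> K")
          case True
          have \<psi>\<phi>: "\<psi> y = \<phi> y" if "norm (y - x) \<le> a" for y
            using KK'[OF True that] by (simp add: \<psi>_def)
          have "(\<Sum>k\<in>S. \<psi> (x - h *\<^sub>R v k) * \<zeta> x + \<psi> (x - (- h) *\<^sub>R v k) * \<zeta> x - 2 * (\<psi> (x - 0) * \<zeta> x))
            = \<zeta> x * (\<Sum>k\<in>S. \<phi> (x + h *\<^sub>R v k) + \<phi> (x - h *\<^sub>R v k) - 2 * \<phi> x)"
            using ha h a unfolding sum_distrib_left by (intro sum.cong) (simp_all add: \<psi>\<phi> algebra_simps)
          also have "\<dots> \<le> 0"
            using sd_K[OF h True] \<zeta>0 by (simp add: mult_nonneg_nonpos)
          finally show ?thesis .
        qed (simp add: \<zeta>K)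
        then show "0 \<le> - ((\<Sum>k\<in>S. \<psi> (x - h *\<^sub>R v k) * \<zeta> x + \<psi> (x - (- h) *\<^sub>R v k) * \<zeta> x
            - 2 * (\<psi> (x - 0) * \<zeta> x)) / h\<^sup>2)"
          unfolding neg_0_le_iff_le by (rule divide_nonpos_nonneg) simp
      qed
      finally show ?thesis .
    qed
    have lim: "filterlim (\<lambda>n. inverse (real (Suc n))) (at_right 0) sequentially"
      using LIMSEQ_inverse_real_of_nat by (simp add: filterlim_at del: of_nat_Suc)
    have "(\<lambda>n. LINT x|lebesgue. \<psi> x * q (inverse (real (Suc n))) x)
        \<longlonglongrightarrow> (LINT x|lebesgue. \<psi> x * (\<Sum>k\<in>S. hessian_form \<zeta> (v k) x))"
    proof (rule integral_dominated_convergence)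
      show "integrable lebesgue (\<lambda>x. \<bar>\<psi> x\<bar> * (\<Sum>k\<in>S. B (v k)))" using \<psi> by simp
      show "(\<lambda>x. \<psi> x * (\<Sum>k\<in>S. hessian_form \<zeta> (v k) x)) \<in> borel_measurable lebesgue"
        by (intro borel_measurable_integrable bounded_int)
           (auto intro!: continuous_intros continuous_on_hessian_form[OF C2] simp: hK)
      show "(\<lambda>x. \<psi> x * q (inverse (real (Suc n))) x) \<in> borel_measurable lebesgue" for n
        by (intro borel_measurable_integrable integrable_lebesgue_mult_bounded_continuous[OF \<psi> cont_q q_bound])
           simp_all
      show "AE x in lebesgue. norm (\<psi> x * q (inverse (real (Suc n))) x) \<le> \<bar>\<psi> x\<bar> * (\<Sum>k\<in>S. B (v k))" for n
        using q_bound[of "inverse (real (Suc n))"] by (simp add: abs_mult mult_left_mono)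
      have "((\<lambda>h. \<psi> x * q h x) \<longlongrightarrow> \<psi> x * (\<Sum>k\<in>S. hessian_form \<zeta> (v k) x)) (at_right 0)" for x
        unfolding q_def by (intro tendsto_intros second_difference_tendsto[OF C2])
      then show "AE x in lebesgue. (\<lambda>n. \<psi> x * q (inverse (real (Suc n))) x)
          \<longlonglongrightarrow> \<psi> x * (\<Sum>k\<in>S. hessian_form \<zeta> (v k) x)"
        using filterlim_compose[OF _ lim] by (intro AE_I2) blast
    qed
    moreover have "eventually (\<lambda>n. (LINT x|lebesgue. \<psi> x * q (inverse (real (Suc n))) x) \<le> 0) sequentially"
    proof -
      \<comment> \<open>Below this threshold every shift \<open>h *\<^sub>R v k\<close> has length
        at most \<open>a\<close>; the summand 1 keeps the denominator positive.\<close>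
      define h1 where "h1 = min h0 (a / (1 + (\<Sum>k\<in>S. norm (v k))))"
      have pos: "0 < 1 + (\<Sum>k\<in>S. norm (v k))" by (simp add: add_pos_nonneg sum_nonneg)
      have "0 < h1" using h0 a pos by (simp add: h1_def)
      have "(LINT x|lebesgue. \<psi> x * q h x) \<le> 0" if "0 < h" "h < h1" for h
      proof (rule le0[OF that(1)])
        show "h < h0" using that by (simp add: h1_def)
        fix k assume "k \<in> S"
        have "norm (v k) \<le> 1 + (\<Sum>k\<in>S. norm (v k))"
          using member_le_sum[OF \<open>k \<in> S\<close>, of "\<lambda>k. norm (v k)"] fin by simp
        then have "h * norm (v k) \<le> h * (1 + (\<Sum>k\<in>S. norm (v k)))" using that by simp
        also have "\<dots> \<le> a" using that pos by (simp add: h1_def field_simps)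
        finally show "h * norm (v k) \<le> a" .
      qed
      moreover have "eventually (\<lambda>h. 0 < h \<and> h < h1) (at_right 0)"
        using \<open>0 < h1\<close> by (auto simp: eventually_at_right_field)
      ultimately have "eventually (\<lambda>h. (LINT x|lebesgue. \<psi> x * q h x) \<le> 0) (at_right 0)"
        by (auto elim: eventually_mono)
      from eventually_compose_filterlim[OF this lim] show ?thesis .
    qed
    ultimately show ?thesis
      by (rule tendsto_upperbound) simp
  qed
  finally show "second_order_distr A \<Omega> \<phi> \<zeta> \<le> 0" .
qed

section \<open>The infimum of exterior barriers\<close>

text \<open>
  The concave term is dominated by the linear one for \<open>0 \<le> \<delta> - y \<bullet> e \<le> 2\<close>, and the last summand \<open>\<delta>\<close> keeps
  the barrier away from \<open>0\<close> near the center.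
\<close>

definition barrier :: "real \<Rightarrow> real \<Rightarrow> 'a::real_inner \<Rightarrow> 'a \<Rightarrow> real" where
  "barrier \<kappa> \<delta> e y = (\<delta> - y \<bullet> e) - (\<delta> - y \<bullet> e)\<^sup>2 / 4 + \<kappa> * (norm y)\<^sup>2 + \<delta>"

text \<open>For a quadratic function the second difference is exact and independent of
  \<open>y\<close>. The concave term contributes the negative part, which outweighs the
  \<open>\<kappa>\<close> part after summation over the vectors of an elliptic matrix.\<close>

lemma barrier_second_difference:
  "barrier \<kappa> \<delta> e (y + z) + barrier \<kappa> \<delta> e (y - z) - 2 * barrier \<kappa> \<delta> e y
    = 2 * \<kappa> * (norm z)\<^sup>2 - (z \<bullet> e)\<^sup>2 / 2"
  unfolding barrier_def power2_norm_eq_inner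
  by (simp add: inner_add_left inner_diff_left inner_add_right
      inner_diff_right power2_eq_square inner_commute[of z y] field_simps)

text \<open>With \<open>t = \<delta> - y \<bullet> e\<close> in the interval from 0 to 2, the value
  of \<open>t - t\<^sup>2 / 4\<close> lies between 0 and \<open>t\<close>, and \<open>t\<close> is
  at most \<open>\<delta> + norm y\<close>.\<close>

lemma barrier_bounds:
  assumes "norm e = 1" "y \<bullet> e < \<delta>" "norm y < 1" "0 < \<delta>" "\<delta> \<le> 1" "0 < \<kappa>" "\<kappa> \<le> 1"
  shows "\<delta> + \<kappa> * (norm y)\<^sup>2 \<le> barrier \<kappa> \<delta> e y"
    and "barrier \<kappa> \<delta> e y \<le> 2 * \<delta> + norm y + (norm y)\<^sup>2"
proof -
  define t where "t = \<delta> - y \<bullet> e"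
  have ye: "\<bar>y \<bullet> e\<bar> \<le> norm y"
    using Cauchy_Schwarz_ineq2[of y e] assms(1) by simp
  then have t: "0 < t" "t \<le> 2" "t \<le> \<delta> + norm y"
    using assms by (auto simp: t_def)
  have "t * t \<le> 4 * t" using t by (intro mult_right_mono) auto
  then show "\<delta> + \<kappa> * (norm y)\<^sup>2 \<le> barrier \<kappa> \<delta> e y"
    by (simp add: barrier_def power2_eq_square flip: t_def)
  have "\<kappa> * (norm y)\<^sup>2 \<le> (norm y)\<^sup>2" using assms by (simp add: mult_left_le_one_le)
  then show "barrier \<kappa> \<delta> e y \<le> 2 * \<delta> + norm y + (norm y)\<^sup>2"
    using t(3) zero_le_power2[of t] unfolding barrier_def t_def[symmetric] by linarith
qed

text \<open>A ball is connected, so if it met both \<open>S\<close> and the complement it would meet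
  the frontier, at a distance less than the infimum.\<close>

lemma ball_infdist_frontier_subset:
  fixes x :: "'a::euclidean_space"
  assumes "x \<in> S"
  shows "ball x (infdist x (frontier S)) \<subseteq> S"
proof (rule ccontr)
  assume "\<not> ball x (infdist x (frontier S)) \<subseteq> S"
  moreover from this have "0 < infdist x (frontier S)"
    by (metis ball_empty empty_subsetI not_le)
  then have "x \<in> ball x (infdist x (frontier S))" by simp
  ultimately have "ball x (infdist x (frontier S)) \<inter> frontier S \<noteq> {}"
    using assms by (intro connected_Int_frontier) blast+
  then show False
    using infdist_le[of _ "frontier S" x] by fastforce
qed

section \<open>Families of barriers over all scales\<close>

text \<open>The scales are indexed by all integers, so the radii reach both 0 and infinity.
  \<open>w_step\<close> says that the upper bound \<open>4 * r * w (n + 1)\<close> for the next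
  barrier, valid well inside its ball, is at most the lower bound \<open>\<kappa> * w n / 4\<close>
  for the present one in the outer half of its ball.\<close>

locale exterior_barriers =
  fixes \<Omega> :: "(real^'n) set" and R w :: "int \<Rightarrow> real" and \<kappa> \<delta> r :: real
  assumes open_\<Omega>: "open \<Omega>" and frontier_nonempty: "frontier \<Omega> \<noteq> {}"
    and \<kappa>: "0 < \<kappa>" "\<kappa> \<le> 1" and \<delta>: "0 < \<delta>" "\<delta> \<le> r" and r: "r \<le> 1/2"
    and R_pos: "0 < R n" and w_pos: "0 < w n"
    and R_step: "R n \<le> r * R (n + 1)"
    and w_step: "16 * r * w (n + 1) \<le> \<kappa> * w n"
    and exterior: "p \<in> frontier \<Omega> \<Longrightarrow> C \<in> components (\<Omega> \<inter> ball p (R n)) \<Longrightarrow>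
      \<exists>e. norm e = 1 \<and> (\<forall>x\<in>C. (x - p) \<bullet> e < \<delta> * R n)"
begin

definition admissible :: "int \<Rightarrow> real^'n \<Rightarrow> real^'n \<Rightarrow> (real^'n) set \<Rightarrow> bool" where
  "admissible n p e C \<longleftrightarrow> p \<in> frontier \<Omega> \<and> norm e = 1 \<and> C \<in> components (\<Omega> \<inter> ball p (R n)) \<and>
     (\<forall>x\<in>C. (x - p) \<bullet> e < \<delta> * R n)"

definition scaled_barrier :: "int \<Rightarrow> real^'n \<Rightarrow> real^'n \<Rightarrow> real^'n \<Rightarrow> real" where
  "scaled_barrier n p e x = w n * barrier \<kappa> \<delta> e ((1 / R n) *\<^sub>R (x - p))"

definition barrier_values :: "real^'n \<Rightarrow> real set" where
  "barrier_values x = {scaled_barrier n p e x |n p e C. admissible n p e C \<and> x \<in> C}"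

definition inf_barrier :: "real^'n \<Rightarrow> real" where
  "inf_barrier x = Inf (barrier_values x)"

lemma admissibleD:
  assumes "admissible n p e C" "x \<in> C"
  shows "p \<in> frontier \<Omega>" "x \<in> \<Omega>" "dist x p < R n"
    and "norm ((1 / R n) *\<^sub>R (x - p)) = dist x p / R n"
    and "w n * (\<delta> + \<kappa> * (dist x p / R n)\<^sup>2) \<le> scaled_barrier n p e x"
    and "scaled_barrier n p e x \<le> w n * (2 * \<delta> + dist x p / R n + (dist x p / R n)\<^sup>2)"
proof -
  have "C \<subseteq> \<Omega> \<inter> ball p (R n)"
    by (metis admissible_def assms(1) in_components_subset)
  with assms show x: "p \<in> frontier \<Omega>" "x \<in> \<Omega>" "dist x p < R n"
    by (auto simp: admissible_def dist_commute)
  show y: "norm ((1 / R n) *\<^sub>R (x - p)) = dist x p / R n"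
    using R_pos[of n] by (simp add: dist_norm)
  have "((1 / R n) *\<^sub>R (x - p)) \<bullet> e = (x - p) \<bullet> e / R n"
    by (simp only: inner_scaleR_left) simp
  then have e: "norm e = 1" "((1 / R n) *\<^sub>R (x - p)) \<bullet> e < \<delta>"
    using assms R_pos[of n] by (simp_all only: admissible_def pos_divide_less_eq)
  have lt: "norm ((1 / R n) *\<^sub>R (x - p)) < 1"
    unfolding y using x R_pos[of n] by simp
  note bounds = barrier_bounds[OF e lt \<delta>(1) _ \<kappa>, unfolded y]
  show "w n * (\<delta> + \<kappa> * (dist x p / R n)\<^sup>2) \<le> scaled_barrier n p e x"
    "scaled_barrier n p e x \<le> w n * (2 * \<delta> + dist x p / R n + (dist x p / R n)\<^sup>2)"
    unfolding scaled_barrier_def using \<delta> r w_pos[of n]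
    by (auto intro!: mult_left_mono bounds)
qed

lemma admissible_exists:
  assumes "p \<in> frontier \<Omega>" "x \<in> \<Omega>" "dist x p < R n"
  obtains e C where "admissible n p e C" "x \<in> C"
proof -
  have x: "x \<in> \<Omega> \<inter> ball p (R n)" using assms by (simp add: dist_commute)
  then obtain C where C: "C \<in> components (\<Omega> \<inter> ball p (R n))" "x \<in> C"
    by (metis UnionE Union_components)
  then show ?thesis
    using that exterior[OF assms(1) C(1)] assms(1) by (auto simp: admissible_def)
qed

lemma R_mono_ge: "2 ^ k * R 0 \<le> R (int k)" "2 ^ k * R (- int k) \<le> R 0"
proof -
  have step: "2 * R n \<le> R (n + 1)" for n
  proof -
    have "r * R (n + 1) \<le> 1/2 * R (n + 1)"
      using R_pos[of "n + 1"] by (intro mult_right_mono[OF r]) simp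
    with R_step[of n] show ?thesis by linarith
  qed
  show "2 ^ k * R 0 \<le> R (int k)"
  proof (induction k)
    case (Suc k)
    then show ?case using step[of "int k"] by (simp add: add.commute)
  qed simp
  show "2 ^ k * R (- int k) \<le> R 0"
  proof (induction k)
    case (Suc k)
    have "2 ^ Suc k * R (- int (Suc k)) = 2 ^ k * (2 * R (- int (Suc k)))" by simp
    also have "\<dots> \<le> 2 ^ k * R (- int k)"
      using step[of "- int (Suc k)"] by (intro mult_left_mono) auto
    also note Suc
    finally show ?case .
  qed simp
qed

text \<open>The radii at least double at each step, so they exceed \<open>s\<close> for some index
  and drop to at most \<open>s\<close> for another.\<close>

lemma scale_exists:
  assumes "0 < s"
  obtains n where "R (n - 1) \<le> s" "s < R n"
proof -
  obtain k where "s / R 0 < 2 ^ k"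
    using real_arch_pow[of 2 "s / R 0"] by auto
  then have k: "s < R (int k)"
    using R_mono_ge(1)[of k] R_pos[of 0] by (simp add: field_simps)
  obtain l where "R 0 / s < 2 ^ l"
    using real_arch_pow[of 2 "R 0 / s"] by auto
  then have "R 0 < 2 ^ l * s" using assms by (simp add: field_simps)
  also have "\<dots> \<le> 2 ^ (k + l) * s"
    using assms by (intro mult_right_mono power_increasing) auto
  finally have "2 ^ (k + l) * R (- int (k + l)) < 2 ^ (k + l) * s"
    using R_mono_ge(2)[of "k + l"] by linarith
  then have l: "R (- int (k + l)) \<le> s" by simp
  have "\<exists>n. R (n - 1) \<le> s \<and> s < R n"
  proof (rule ccontr)
    assume no: "\<nexists>n. R (n - 1) \<le> s \<and> s < R n"
    have "s < R n" if "n \<le> int k" for n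
      using that by (induction n rule: int_le_induct) (use k no in force)+
    from this[of "- int (k + l)"] l show False by simp
  qed
  with that show ?thesis by blast
qed

section \<open>The pointwise infimum and its second differences\<close>

lemma barrier_values_nonempty:
  assumes "x \<in> \<Omega>"
  shows "barrier_values x \<noteq> {}"
proof -
  obtain p where p: "p \<in> frontier \<Omega>" using frontier_nonempty by blast
  obtain n where "dist x p + 1 < R n"
    using scale_exists[of "dist x p + 1"] by (metis add_nonneg_pos zero_le_dist zero_less_one)
  then have "dist x p < R n" by simp
  then obtain e C where "admissible n p e C" "x \<in> C"
    using admissible_exists[OF p assms] by blast
  then show ?thesis by (auto simp: barrier_values_def)
qed

lemma scaled_barrier_pos:
  assumes "admissible n p e C" "x \<in> C"
  shows "0 < scaled_barrier n p e x"
proof -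
  have "0 < w n * (\<delta> + \<kappa> * (dist x p / R n)\<^sup>2)"
    using w_pos[of n] \<delta> \<kappa> by (intro mult_pos_pos add_pos_nonneg) auto
  with admissibleD(5)[OF assms] show ?thesis by linarith
qed

lemma bdd_below_barrier_values: "bdd_below (barrier_values x)"
  by (rule bdd_belowI[of _ 0]) (auto simp: barrier_values_def dest!: scaled_barrier_pos)

lemma inf_barrier_le:
  assumes "admissible n p e C" "x \<in> C"
  shows "inf_barrier x \<le> scaled_barrier n p e x"
  unfolding inf_barrier_def
  by (rule cInf_lower[OF _ bdd_below_barrier_values]) (use assms in \<open>auto simp: barrier_values_def\<close>)

text \<open>The gluing step: near-minimal barriers can be chosen with \<open>x\<close> in the inner
  half of their ball. If \<open>x\<close> lies in the outer half, the barrier of the next radius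
  around the same \<open>p\<close> is no larger at \<open>x\<close>, and \<open>x\<close> is in the
  inner half of that larger ball.\<close>

lemma inf_barrier_approx:
  assumes "x \<in> \<Omega>" "0 < \<eta>"
  obtains n p e C where "admissible n p e C" "x \<in> C" "dist x p \<le> R n / 2"
    "scaled_barrier n p e x < inf_barrier x + \<eta>"
proof -
  have "Inf (barrier_values x) < inf_barrier x + \<eta>"
    using assms by (simp add: inf_barrier_def)
  then obtain n p e C where a: "admissible n p e C" "x \<in> C"
    and lt: "scaled_barrier n p e x < inf_barrier x + \<eta>"
    using cInf_less_iff[OF barrier_values_nonempty[OF assms(1)] bdd_below_barrier_values]
    by (auto simp: barrier_values_def)
  note aD = admissibleD[OF a]
  show ?thesis
  proof (cases "dist x p \<le> R n / 2")
    case True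
    with a lt that show ?thesis by blast
  next
    case False
    let ?m = "n + 1"
    have le: "dist x p \<le> r * R ?m" using aD(3) R_step[of n] by simp
    also have "\<dots> \<le> 1/2 * R ?m" using R_pos[of ?m] by (intro mult_right_mono[OF r]) simp
    finally have half: "dist x p \<le> R ?m / 2" by simp
    with R_pos[of ?m] have "dist x p < R ?m" by linarith
    then obtain e' C' where a': "admissible ?m p e' C'" "x \<in> C'"
      using admissible_exists[OF aD(1,2)] by blast
    define s where "s = dist x p / R ?m"
    have s: "0 \<le> s" "s \<le> r" using le R_pos[of ?m] by (simp_all add: s_def field_simps)
    have "s\<^sup>2 \<le> r" using mult_mono[of s r s 1] s r by (simp add: power2_eq_square)
    with s \<delta> have "2 * \<delta> + s + s\<^sup>2 \<le> 4 * r" by linarith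
    then have "w ?m * (2 * \<delta> + s + s\<^sup>2) \<le> w ?m * (4 * r)"
      using w_pos[of ?m] by (intro mult_left_mono) auto
    then have "scaled_barrier ?m p e' x \<le> w ?m * (4 * r)"
      using admissibleD(6)[OF a'] by (simp add: s_def)
    \<comment> \<open>This is \<open>w_step\<close> divided by 4.\<close>
    also have "\<dots> \<le> w n * (\<kappa> * (1/2)\<^sup>2)"
      using w_step[of n] by (simp add: power2_eq_square algebra_simps)
    also have "\<dots> \<le> w n * (\<delta> + \<kappa> * (dist x p / R n)\<^sup>2)"
    proof -
      have "(1/2)\<^sup>2 \<le> (dist x p / R n)\<^sup>2"
        using False R_pos[of n] by (intro power_mono) (simp_all add: field_simps)
      then have "\<kappa> * (1/2)\<^sup>2 \<le> \<kappa> * (dist x p / R n)\<^sup>2"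
        using \<kappa> by (intro mult_left_mono) auto
      then show ?thesis
        using \<delta> w_pos[of n] by (intro mult_left_mono) auto
    qed
    also have "\<dots> \<le> scaled_barrier n p e x" by (rule aD(5))
    finally show ?thesis using a' half lt that by fastforce
  qed
qed

lemma scaled_barrier_second_differences:
  assumes e: "norm e = 1" and v: "\<And>e. norm e = 1 \<Longrightarrow> 4 * \<kappa> * (\<Sum>k\<in>S. (norm (v k))\<^sup>2) \<le> (\<Sum>k\<in>S. (v k \<bullet> e)\<^sup>2)"
  shows "(\<Sum>k\<in>S. scaled_barrier n p e (x + h *\<^sub>R v k) + scaled_barrier n p e (x - h *\<^sub>R v k)
      - 2 * scaled_barrier n p e x) \<le> 0"
proof -
  define y where "y = (1 / R n) *\<^sub>R (x - p)"
  have "scaled_barrier n p e (x + h *\<^sub>R v k) + scaled_barrier n p e (x - h *\<^sub>R v k) - 2 * scaled_barrier n p e x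
      = w n * (h / R n)\<^sup>2 * ((4 * \<kappa> * (norm (v k))\<^sup>2 - (v k \<bullet> e)\<^sup>2) / 2)" for k
  proof -
    have "scaled_barrier n p e (x + h *\<^sub>R v k) = w n * barrier \<kappa> \<delta> e (y + (h / R n) *\<^sub>R v k)"
      "scaled_barrier n p e (x - h *\<^sub>R v k) = w n * barrier \<kappa> \<delta> e (y - (h / R n) *\<^sub>R v k)"
      by (simp_all add: scaled_barrier_def y_def algebra_simps)
    then have "scaled_barrier n p e (x + h *\<^sub>R v k) + scaled_barrier n p e (x - h *\<^sub>R v k) - 2 * scaled_barrier n p e x
      = w n * (barrier \<kappa> \<delta> e (y + (h / R n) *\<^sub>R v k) + barrier \<kappa> \<delta> e (y - (h / R n) *\<^sub>R v k) - 2 * barrier \<kappa> \<delta> e y)"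
      by (simp add: scaled_barrier_def y_def algebra_simps)
    also have "\<dots> = w n * (h / R n)\<^sup>2 * ((4 * \<kappa> * (norm (v k))\<^sup>2 - (v k \<bullet> e)\<^sup>2) / 2)"
      unfolding barrier_second_difference by (simp add: power_mult_distrib power_divide algebra_simps diff_divide_distrib)
    finally show ?thesis .
  qed
  then have "(\<Sum>k\<in>S. scaled_barrier n p e (x + h *\<^sub>R v k) + scaled_barrier n p e (x - h *\<^sub>R v k)
      - 2 * scaled_barrier n p e x) = w n * (h / R n)\<^sup>2 * ((4 * \<kappa> * (\<Sum>k\<in>S. (norm (v k))\<^sup>2) - (\<Sum>k\<in>S. (v k \<bullet> e)\<^sup>2)) / 2)"
    by (simp only: sum_distrib_left sum_divide_distrib flip: sum_subtractf)
  also have "\<dots> \<le> 0"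
    using v[OF e] w_pos[of n] by (intro mult_nonneg_nonpos) auto
  finally show ?thesis .
qed

text \<open>A near-minimal barrier at \<open>x\<close> lies above the infimum at the shifted points,
  because these stay in the same component, and almost equals it at \<open>x\<close>. Its own second
  differences are nonpositive, and the error is made arbitrarily small.\<close>

lemma inf_barrier_second_differences:
  assumes "finite S" and x: "x \<in> \<Omega>" and "0 < h"
    and small: "\<And>k. k \<in> S \<Longrightarrow> 2 * (h * norm (v k)) \<le> infdist x (frontier \<Omega>)"
    and v: "\<And>e. norm e = 1 \<Longrightarrow> 4 * \<kappa> * (\<Sum>k\<in>S. (norm (v k))\<^sup>2) \<le> (\<Sum>k\<in>S. (v k \<bullet> e)\<^sup>2)"
  shows "(\<Sum>k\<in>S. inf_barrier (x + h *\<^sub>R v k) + inf_barrier (x - h *\<^sub>R v k) - 2 * inf_barrier x) \<le> 0"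
proof (rule field_le_epsilon)
  fix \<eta> :: real assume "0 < \<eta>"
  \<comment> \<open>Each of the \<open>card S\<close> terms costs \<open>2 * \<eta>'\<close>; the
    added 1 covers empty \<open>S\<close>.\<close>
  define \<eta>' where "\<eta>' = \<eta> / (2 * card S + 1)"
  have \<eta>': "0 < \<eta>'" "2 * card S * \<eta>' \<le> \<eta>" using \<open>0 < \<eta>\<close> by (simp_all add: \<eta>'_def field_simps)
  obtain n p e C where a: "admissible n p e C" "x \<in> C" and half: "dist x p \<le> R n / 2"
    and lt: "scaled_barrier n p e x < inf_barrier x + \<eta>'"
    using inf_barrier_approx[OF x \<eta>'(1)] .
  let ?f = "scaled_barrier n p e"
  define d where "d = infdist x (frontier \<Omega>)"
  have "x \<notin> frontier \<Omega>" using x open_\<Omega> by (simp add: frontier_def interior_open)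
  then have d: "0 < d" unfolding d_def
    using frontier_nonempty infdist_pos_not_in_closed[of "frontier \<Omega>" x] by simp
  have dp: "d \<le> dist x p"
    using admissibleD(1)[OF a] by (simp add: d_def infdist_le)
  \<comment> \<open>Since \<open>d \<le> dist x p \<le> R n / 2\<close>, points of this ball are
    within \<open>3 / 4 * R n\<close> of \<open>p\<close>. Being connected, the ball then lies in
    the single component \<open>C\<close>.\<close>
  have "cball x (d / 2) \<subseteq> \<Omega> \<inter> ball p (R n)"
  proof
    fix z assume z: "z \<in> cball x (d / 2)"
    then have "z \<in> ball x d" using d by simp
    then have "z \<in> \<Omega>" using ball_infdist_frontier_subset[OF x] by (auto simp: d_def)
    moreover have "dist p z < R n"
      using z dp half R_pos[of n] dist_triangle[of p z x] by (simp add: dist_commute)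
    ultimately show "z \<in> \<Omega> \<inter> ball p (R n)" by simp
  qed
  then have C: "cball x (d / 2) \<subseteq> C"
    using a d by (intro components_maximal[of C]) (auto simp: admissible_def intro!: exI[of _ x])
  have le: "inf_barrier (x + h *\<^sub>R v k) + inf_barrier (x - h *\<^sub>R v k) - 2 * inf_barrier x
      \<le> (?f (x + h *\<^sub>R v k) + ?f (x - h *\<^sub>R v k) - 2 * ?f x) + 2 * \<eta>'" if k: "k \<in> S" for k
  proof -
    have "x + h *\<^sub>R v k \<in> cball x (d / 2)" "x - h *\<^sub>R v k \<in> cball x (d / 2)"
      using small[OF k] \<open>0 < h\<close> by (simp_all add: d_def dist_norm)
    with C have "x + h *\<^sub>R v k \<in> C" "x - h *\<^sub>R v k \<in> C" by blast+
    from this[THEN inf_barrier_le[OF a(1)]] lt show ?thesis by linarith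
  qed
  have "(\<Sum>k\<in>S. inf_barrier (x + h *\<^sub>R v k) + inf_barrier (x - h *\<^sub>R v k) - 2 * inf_barrier x)
      \<le> (\<Sum>k\<in>S. (?f (x + h *\<^sub>R v k) + ?f (x - h *\<^sub>R v k) - 2 * ?f x) + 2 * \<eta>')"
    by (rule sum_mono[OF le])
  also have "\<dots> = (\<Sum>k\<in>S. ?f (x + h *\<^sub>R v k) + ?f (x - h *\<^sub>R v k) - 2 * ?f x) + 2 * card S * \<eta>'"
    by (subst sum.distrib) simp
  also have "\<dots> \<le> 0 + \<eta>"
    using a \<eta>'(2) by (intro add_mono scaled_barrier_second_differences v) (auto simp: admissible_def)
  finally show "(\<Sum>k\<in>S. inf_barrier (x + h *\<^sub>R v k) + inf_barrier (x - h *\<^sub>R v k) - 2 * inf_barrier x) \<le> 0 + \<eta>" .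
qed

section \<open>Measurability, growth and integrability of the infimum\<close>

text \<open>A strict sublevel set of an infimum is the union of those of the individual barriers.
  These are open, so the union may be uncountable.\<close>

lemma inf_barrier_measurable: "inf_barrier \<in> borel_measurable (lebesgue_on \<Omega>)"
  unfolding borel_measurable_iff_less
proof
  fix a
  have "{x \<in> \<Omega>. inf_barrier x < a}
      = (\<Union>(n, p, e, C) \<in> {(n, p, e, C). admissible n p e C}. {x \<in> C. scaled_barrier n p e x < a})"
    (is "_ = ?U")
  proof (intro set_eqI iffI)
    fix x assume "x \<in> {x \<in> \<Omega>. inf_barrier x < a}"
    then have "x \<in> \<Omega>" "0 < a - inf_barrier x" by auto
    from this have "\<exists>n p e C. admissible n p e C \<and> x \<in> C \<and> scaled_barrier n p e x < a"
      by (rule inf_barrier_approx) auto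
    then show "x \<in> ?U" by blast
  next
    fix x assume "x \<in> ?U"
    then obtain n p e C where "admissible n p e C" "x \<in> C" "scaled_barrier n p e x < a" by blast
    then show "x \<in> {x \<in> \<Omega>. inf_barrier x < a}"
      using inf_barrier_le[of n p e C x] admissibleD(2)[of n p e C x] by simp
  qed
  moreover have "open {x \<in> C. scaled_barrier n p e x < a}" if "admissible n p e C" for n p e C
  proof -
    have "open C"
      using that open_\<Omega> open_components[of "\<Omega> \<inter> ball p (R n)" C] by (simp add: admissible_def open_Int)
    moreover have "continuous_on UNIV (scaled_barrier n p e)"
      unfolding scaled_barrier_def[abs_def] barrier_def by (intro continuous_intros) auto
    then have "open {x. scaled_barrier n p e x < a}"
      by (intro open_Collect_less continuous_intros)
    ultimately show ?thesis by (simp add: Collect_conj_eq open_Int)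
  qed
  ultimately have "open {x \<in> \<Omega>. inf_barrier x < a}" by (auto intro!: open_UN)
  moreover have "open \<Omega>" by (rule open_\<Omega>)
  ultimately show "{x \<in> space (lebesgue_on \<Omega>). inf_barrier x < a} \<in> sets (lebesgue_on \<Omega>)"
    by (auto simp: sets_restrict_space_iff space_restrict_space)
qed

text \<open>Every barrier over \<open>x\<close> is at least \<open>w n * \<delta>\<close>, and its
  radius exceeds the distance from \<open>x\<close> to the frontier.\<close>

lemma inf_barrier_ge:
  assumes "0 \<le> c" "0 \<le> \<beta>" "\<And>n. c * R n powr \<beta> \<le> w n" and x: "x \<in> \<Omega>"
  shows "c * \<delta> * infdist x (frontier \<Omega>) powr \<beta> \<le> inf_barrier x"
  unfolding inf_barrier_def
proof (rule cInf_greatest[OF barrier_values_nonempty[OF x]])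
  fix z assume "z \<in> barrier_values x"
  then obtain n p e C where a: "admissible n p e C" "x \<in> C" and z: "z = scaled_barrier n p e x"
    by (auto simp: barrier_values_def)
  note aD = admissibleD[OF a]
  have "infdist x (frontier \<Omega>) \<le> R n"
    using aD(3) infdist_le[OF aD(1), of x] by simp
  then have "c * infdist x (frontier \<Omega>) powr \<beta> \<le> c * R n powr \<beta>"
    using assms by (intro mult_left_mono powr_mono2 infdist_nonneg) auto
  also have "\<dots> \<le> w n" by fact
  finally have "c * infdist x (frontier \<Omega>) powr \<beta> * \<delta> \<le> w n * \<delta>"
    using \<delta> by (intro mult_right_mono) auto
  also have "\<dots> \<le> w n * (\<delta> + \<kappa> * (dist x p / R n)\<^sup>2)"
    using w_pos[of n] \<kappa> by (intro mult_left_mono) auto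
  also have "\<dots> \<le> z" unfolding z by (rule aD(5))
  finally show "c * \<delta> * infdist x (frontier \<Omega>) powr \<beta> \<le> z" by (simp add: mult_ac)
qed

text \<open>A single barrier suffices: it is centered at a nearest frontier point and has the
  smallest radius exceeding the distance.\<close>

lemma inf_barrier_upper:
  assumes "0 \<le> D" "0 \<le> \<beta>" "\<And>n. w n \<le> D * R (n - 1) powr \<beta>" and x: "x \<in> \<Omega>"
  shows "inf_barrier x \<le> 4 * D * infdist x (frontier \<Omega>) powr \<beta>"
proof -
  have "x \<notin> frontier \<Omega>" using x open_\<Omega> by (simp add: frontier_def interior_open)
  then have "0 < infdist x (frontier \<Omega>)"
    using frontier_nonempty infdist_pos_not_in_closed[of "frontier \<Omega>" x] by simp
  then obtain n where n: "R (n - 1) \<le> infdist x (frontier \<Omega>)" "infdist x (frontier \<Omega>) < R n"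
    using scale_exists by blast
  obtain p where p: "p \<in> frontier \<Omega>" "infdist x (frontier \<Omega>) = dist x p"
    using infdist_attains_inf[OF frontier_closed frontier_nonempty] by metis
  obtain e C where a: "admissible n p e C" "x \<in> C"
    using admissible_exists[OF p(1) x] n(2) p(2) by metis
  define s where "s = dist x p / R n"
  have s: "0 \<le> s" "s \<le> 1" using n(2) p(2) R_pos[of n] by (simp_all add: s_def field_simps)
  have "s\<^sup>2 \<le> 1" using s by (simp add: power_le_one)
  with s \<delta> r have "2 * \<delta> + s + s\<^sup>2 \<le> 4" by linarith
  then have "w n * (2 * \<delta> + s + s\<^sup>2) \<le> w n * 4"
    using w_pos[of n] by (intro mult_left_mono) auto
  then have "inf_barrier x \<le> w n * 4"
    using inf_barrier_le[OF a] admissibleD(6)[OF a] by (simp add: s_def)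
  also have "\<dots> \<le> D * R (n - 1) powr \<beta> * 4" using assms(3)[of n] by simp
  also have "\<dots> \<le> D * infdist x (frontier \<Omega>) powr \<beta> * 4"
    using n(1) assms(1,2) R_pos[of "n - 1"] by (intro mult_right_mono mult_left_mono powr_mono2) auto
  finally show ?thesis by (simp add: mult_ac)
qed

lemma inf_barrier_nonneg:
  assumes "x \<in> \<Omega>"
  shows "0 \<le> inf_barrier x"
  unfolding inf_barrier_def
  by (rule cInf_greatest[OF barrier_values_nonempty[OF assms]])
     (auto simp: barrier_values_def dest!: scaled_barrier_pos)

lemma inf_barrier_locally_integrable:
  assumes D: "0 \<le> D" "0 \<le> \<beta>" "\<And>n. w n \<le> D * R (n - 1) powr \<beta>"
  shows "locally_integrable_on inf_barrier \<Omega>"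
  unfolding locally_integrable_on_def
proof (intro allI impI, elim conjE)
  fix K assume K: "compact K" "K \<subseteq> \<Omega>"
  interpret finite_measure "lebesgue_on K"
    using K(1) by (intro finite_measure_lebesgue_on lmeasurable_compact)
  obtain p where p: "p \<in> frontier \<Omega>" using frontier_nonempty by blast
  obtain M where M: "\<And>x. x \<in> K \<Longrightarrow> dist p x \<le> M"
    using compact_imp_bounded[OF K(1)] bounded_any_center[of K p] by blast
  have "\<bar>inf_barrier x\<bar> \<le> 4 * D * M powr \<beta>" if x: "x \<in> K" for x
  proof -
    have "infdist x (frontier \<Omega>) \<le> M"
      using infdist_le[OF p, of x] M[OF x] by (simp add: dist_commute)
    then have "4 * D * infdist x (frontier \<Omega>) powr \<beta> \<le> 4 * D * M powr \<beta>"
      using D(1,2) by (intro mult_left_mono powr_mono2 infdist_nonneg) auto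
    with inf_barrier_upper[OF D, of x] inf_barrier_nonneg[of x] x K(2) show ?thesis by auto
  qed
  moreover have "inf_barrier \<in> borel_measurable (lebesgue_on K)"
    using inf_barrier_measurable K(2) by (rule measurable_restrict_mono)
  ultimately show "integrable (lebesgue_on K) inf_barrier"
    by (intro integrable_const_bound[of _ "4 * D * M powr \<beta>"]) (auto simp: space_restrict_space)
qed

text \<open>On a compact subset the distance to the frontier has a positive lower bound, which
  yields one threshold for \<open>h\<close> valid at all its points.\<close>

lemma inf_barrier_distr_nonpos:
  assumes "finite S" "locally_integrable_on inf_barrier \<Omega>"
    and A: "\<And>i j. A $ i $ j = (\<Sum>k\<in>S. v k $ i * v k $ j)"
    and v: "\<And>e. norm e = 1 \<Longrightarrow> 4 * \<kappa> * (\<Sum>k\<in>S. (norm (v k))\<^sup>2) \<le> (\<Sum>k\<in>S. (v k \<bullet> e)\<^sup>2)"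
  shows "distr_nonpos \<Omega> (second_order_distr A \<Omega> inf_barrier)"
proof (rule distr_nonpos_if_second_differences_nonpos[OF assms(1) open_\<Omega> assms(2) A])
  fix K :: "(real^'n) set" assume K: "compact K" "K \<subseteq> \<Omega>"
  obtain a where a: "0 < a" "(\<Union>x\<in>K. cball x a) \<subseteq> \<Omega>"
    using compact_subset_open_imp_cball_epsilon_subset[OF K(1) open_\<Omega> K(2)] by blast
  have far: "a \<le> infdist x (frontier \<Omega>)" if x: "x \<in> K" for x
    unfolding infdist_notempty[OF frontier_nonempty]
  proof (rule cINF_greatest[OF frontier_nonempty])
    fix p assume "p \<in> frontier \<Omega>"
    then have "p \<notin> \<Omega>" using open_\<Omega> by (simp add: frontier_def interior_open)
    moreover have "cball x a \<subseteq> \<Omega>" using a(2) x by blast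
    ultimately have "p \<notin> cball x a" by blast
    then show "a \<le> dist x p" by simp
  qed
  define h0 where "h0 = a / (2 * (1 + (\<Sum>k\<in>S. norm (v k))))"
  have pos: "0 < 1 + (\<Sum>k\<in>S. norm (v k))" by (simp add: add_pos_nonneg sum_nonneg)
  have "2 * (h * norm (v k)) \<le> a" if "0 < h" "h < h0" "k \<in> S" for h k
  proof -
    have "norm (v k) \<le> 1 + (\<Sum>k\<in>S. norm (v k))"
      using member_le_sum[OF \<open>k \<in> S\<close>, of "\<lambda>k. norm (v k)"] assms(1) by simp
    then have "h * norm (v k) \<le> h * (1 + (\<Sum>k\<in>S. norm (v k)))" using that by simp
    also have "2 * \<dots> \<le> a" using that pos by (simp add: h0_def field_simps)
    finally show ?thesis by simp
  qed
  then have small: "2 * (h * norm (v k)) \<le> infdist x (frontier \<Omega>)"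
    if "0 < h" "h < h0" "x \<in> K" "k \<in> S" for h x k
    using far that by (meson order_trans)
  show "\<exists>h0>0. \<forall>h x. 0 < h \<and> h < h0 \<and> x \<in> K \<longrightarrow>
      (\<Sum>k\<in>S. inf_barrier (x + h *\<^sub>R v k) + inf_barrier (x - h *\<^sub>R v k) - 2 * inf_barrier x) \<le> 0"
  proof (intro exI[of _ h0] conjI allI impI)
    show "0 < h0" using a(1) pos by (simp add: h0_def)
    fix h x assume "0 < h \<and> h < h0 \<and> x \<in> K"
    then show "(\<Sum>k\<in>S. inf_barrier (x + h *\<^sub>R v k) + inf_barrier (x - h *\<^sub>R v k) - 2 * inf_barrier x) \<le> 0"
      using small K(2) by (intro inf_barrier_second_differences[OF assms(1) _ _ _ v]) auto
  qed
qed

end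

section \<open>Scales and weights\<close>

text \<open>The infimum may not be attained, so a strict inequality is asked for; it supplies an
  actual pair with a parameter below \<open>\<delta>\<close>.\<close>

lemma exterior_direction_if_delta_Reifenberg_less:
  assumes "delta_Reifenberg \<Omega> R < \<delta>" "0 < R" "p \<in> frontier \<Omega>" "C \<in> components (\<Omega> \<inter> ball p R)"
  shows "\<exists>e. norm e = 1 \<and> (\<forall>x\<in>C. (x - p) \<bullet> e < \<delta> * R)"
proof -
  obtain \<delta>' where \<delta>': "(\<delta>', R) \<in> exterior_Reifenberg \<Omega>" "\<delta>' < \<delta>"
    using assms(1) cInf_lessD[of "{\<delta>. (\<delta>, R) \<in> exterior_Reifenberg \<Omega>}"] one_in_exterior_Reifenberg[OF assms(2)]
    unfolding delta_Reifenberg_def by blast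
  obtain e where e: "norm e = 1" "C \<subseteq> {x \<in> ball p R. (x - p) \<bullet> e < \<delta>' * R}"
    using \<delta>'(1) assms(3,4) unfolding exterior_Reifenberg_def by blast
  have "\<delta>' * R \<le> \<delta> * R" using \<delta>'(2) assms(2) by simp
  with e show ?thesis by fastforce
qed

lemma powr_divide_eq_minus: "(a / b) powr c = b powr - c * a powr c" for a b c :: real
  by (simp add: powr_divide powr_minus_divide)

text \<open>The condition is imposed with \<open>r / 2\<close> to leave room for the strict
  inequality with \<open>r\<close>. The bound on \<open>r powr (1 - \<beta>)\<close> is what
  \<open>w_step\<close> amounts to when weights grow by \<open>r powr - \<beta>\<close>.\<close>

locale TER_scales =
  fixes \<Omega> :: "(real^'n) set" and R0 Rinf \<kappa> r \<beta> :: real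
  assumes dom: "domain \<Omega>" "\<Omega> \<noteq> UNIV" and TER: "TER_with (r / 2) R0 Rinf \<Omega>"
    and \<kappa>: "0 < \<kappa>" "\<kappa> \<le> 1" and r_bounds: "0 < r" "r \<le> 1/2" "16 * r powr (1 - \<beta>) \<le> \<kappa>" and \<beta>: "0 \<le> \<beta>"
begin

text \<open>
  The radii jump from \<open>R0\<close> to \<open>Rinf / r\<close>, where the condition gives no information, while the weights
  grow by the same factor as elsewhere. This costs a factor \<open>(R0 / Rinf)\<^sup>\<beta>\<close> in the lower bound only.
\<close>

definition scale :: "int \<Rightarrow> real" where
  "scale n = (if n \<le> 0 then R0 else Rinf) * r powr - real_of_int n"

definition weight :: "int \<Rightarrow> real" where
  "weight n = (R0 * r powr - real_of_int n) powr \<beta>"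

lemma radii_pos: "0 < R0" "R0 \<le> Rinf" "0 < Rinf"
  using TER by (auto simp: TER_with_def)

lemma scale_pos: "0 < scale n"
  using radii_pos r_bounds by (simp add: scale_def)

text \<open>The weight is \<open>scale n powr \<beta>\<close> for nonpositive \<open>n\<close> and
  smaller by the factor \<open>(R0 / Rinf) powr \<beta>\<close> for positive \<open>n\<close>. In
  the upper bound, going back one index costs \<open>r powr - \<beta>\<close>.\<close>

lemma weight_bounds:
  "(R0 / Rinf) powr \<beta> * scale n powr \<beta> \<le> weight n"
  "weight n \<le> r powr - \<beta> * scale (n - 1) powr \<beta>"
proof -
  have "(R0 / Rinf) powr \<beta> * scale n powr \<beta> = (R0 / Rinf * scale n) powr \<beta>"
    by (rule powr_mult[symmetric])
  also have "\<dots> \<le> weight n"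
    unfolding weight_def using radii_pos \<beta>
    by (intro powr_mono2) (auto simp: scale_def field_simps intro!: mult_right_mono)
  finally show "(R0 / Rinf) powr \<beta> * scale n powr \<beta> \<le> weight n" .
  have "R0 * r powr - real_of_int n = R0 * r powr - real_of_int (n - 1) / r"
    using r_bounds by (simp add: powr_diff powr_minus field_simps)
  also have "\<dots> \<le> scale (n - 1) / r"
    unfolding scale_def using radii_pos r_bounds by (intro divide_right_mono mult_right_mono) auto
  finally have "weight n \<le> (scale (n - 1) / r) powr \<beta>"
    unfolding weight_def using radii_pos \<beta> by (intro powr_mono2) auto
  also have "\<dots> = r powr - \<beta> * scale (n - 1) powr \<beta>"
    by (rule powr_divide_eq_minus)
  finally show "weight n \<le> r powr - \<beta> * scale (n - 1) powr \<beta>" .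
qed

sublocale exterior_barriers \<Omega> scale weight \<kappa> r r
proof
  show "open \<Omega>" "frontier \<Omega> \<noteq> {}"
    using dom by (auto simp: domain_def frontier_eq_empty)
  show "0 < \<kappa>" "\<kappa> \<le> 1" "0 < r" "r \<le> r" "r \<le> 1/2" using \<kappa> r_bounds by auto
  show "0 < weight n" for n using radii_pos r_bounds by (simp add: weight_def)
  show pos: "0 < scale n" for n by (rule scale_pos)
  have shift: "r powr - real_of_int (n + 1) * r = r powr - real_of_int n" for n
    using r_bounds by (simp add: powr_diff powr_minus field_simps powr_add)
  show "scale n \<le> r * scale (n + 1)" for n
  proof -
    \<comment> \<open>From index 0 to 1 the prefactor changes from \<open>R0\<close> to
      \<open>Rinf\<close>, which can only enlarge the right-hand side; at all other indices equality
      holds.\<close>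
    have "scale n \<le> (if n + 1 \<le> 0 then R0 else Rinf) * r powr - real_of_int n"
      unfolding scale_def using radii_pos by (intro mult_right_mono) auto
    also have "\<dots> = r * scale (n + 1)"
      unfolding scale_def shift[of n, symmetric] by simp
    finally show ?thesis .
  qed
  show "16 * r * weight (n + 1) \<le> \<kappa> * weight n" for n
  proof -
    have "R0 * r powr - real_of_int (n + 1) = R0 * r powr - real_of_int n / r"
      using shift[of n] r_bounds by (simp add: field_simps)
    then have "weight (n + 1) = r powr - \<beta> * weight n"
      by (simp only: weight_def powr_divide_eq_minus)
    moreover have "r * r powr - \<beta> = r powr (1 - \<beta>)"
      using r_bounds powr_add[of r 1 "- \<beta>"] by simp
    ultimately have "16 * r * weight (n + 1) = 16 * r powr (1 - \<beta>) * weight n"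
      by (simp add: mult_ac)
    also have "\<dots> \<le> \<kappa> * weight n"
      using r_bounds(3) by (intro mult_right_mono) (auto simp: weight_def)
    finally show ?thesis .
  qed
  \<comment> \<open>No radius falls strictly between \<open>R0\<close> and \<open>Rinf\<close>, so
    the Reifenberg condition applies at every scale.\<close>
  have "scale n \<le> R0 \<or> Rinf \<le> scale n" for n
  proof (cases "n \<le> 0")
    case True
    then have "r powr - real_of_int n \<le> r powr 0"
      using r_bounds by (intro powr_mono') auto
    then show ?thesis using True radii_pos r_bounds by (simp add: scale_def)
  next
    case False
    then have "r powr 0 \<le> r powr - real_of_int n"
      using r_bounds by (intro powr_mono') auto
    then show ?thesis using False radii_pos r_bounds by (simp add: scale_def)
  qed
  then have "delta_Reifenberg \<Omega> (scale n) \<le> r / 2" for n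
    using TER pos[of n] by (auto simp: TER_with_def)
  then have "delta_Reifenberg \<Omega> (scale n) < r" for n
    using r_bounds by (smt (verit) field_sum_of_halves)
  then show "\<exists>e. norm e = 1 \<and> (\<forall>x\<in>C. (x - p) \<bullet> e < r * scale n)"
    if "p \<in> frontier \<Omega>" "C \<in> components (\<Omega> \<inter> ball p (scale n))" for p C n
    using exterior_direction_if_delta_Reifenberg_less pos that by blast
qed

text \<open>\<open>N\<close> adds the constant of the upper bound to the reciprocal of the constant
  of the lower bound, so it serves for both.\<close>

lemma inf_barrier_two_sided:
  assumes x: "x \<in> \<Omega>" and N: "N = 4 * r powr - \<beta> + 1 / r * (R0 / Rinf) powr - \<beta>"
  shows "inverse N * infdist x (frontier \<Omega>) powr \<beta> \<le> inf_barrier x"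
    and "inf_barrier x \<le> N * infdist x (frontier \<Omega>) powr \<beta>"
proof -
  have q: "0 < (R0 / Rinf) powr \<beta>" "0 < r powr - \<beta>" using radii_pos r_bounds by simp_all
  have "inverse ((R0 / Rinf) powr \<beta> * r) = 1 / r * (R0 / Rinf) powr - \<beta>"
    unfolding powr_minus by (simp only: inverse_mult_distrib divide_inverse mult_1_left mult.commute)
  also have "\<dots> \<le> N"
    using q unfolding N by simp
  finally have "inverse N \<le> inverse (inverse ((R0 / Rinf) powr \<beta> * r))"
    using q r_bounds by (intro le_imp_inverse_le) auto
  then have "inverse N * infdist x (frontier \<Omega>) powr \<beta> \<le> (R0 / Rinf) powr \<beta> * r * infdist x (frontier \<Omega>) powr \<beta>"
    by (intro mult_right_mono) auto
  also have "\<dots> \<le> inf_barrier x"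
    using weight_bounds(1) \<beta> x by (intro inf_barrier_ge) auto
  finally show "inverse N * infdist x (frontier \<Omega>) powr \<beta> \<le> inf_barrier x" .
  have "inf_barrier x \<le> 4 * r powr - \<beta> * infdist x (frontier \<Omega>) powr \<beta>"
    using weight_bounds(2) \<beta> x by (intro inf_barrier_upper) auto
  also have "\<dots> \<le> N * infdist x (frontier \<Omega>) powr \<beta>"
    using q r_bounds unfolding N by (intro mult_right_mono) auto
  finally show "inf_barrier x \<le> N * infdist x (frontier \<Omega>) powr \<beta>" .
qed

end

theorem theorem6p17:
  fixes \<nu> \<epsilon> :: real
  assumes "CARD('n::finite) \<ge> 2"
    and "0 < \<nu>" "\<nu> \<le> 1"
    and "0 < \<epsilon>" "\<epsilon> < 1"
  shows "\<exists>\<delta>1. 0 < \<delta>1 \<and> \<delta>1 \<le> 1 \<and>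
    (\<exists>N :: real \<Rightarrow> real. (\<forall>r. 0 < N r) \<and>
      (\<forall>(\<Omega> :: (real^'n) set) R0 Rinf.
        domain \<Omega> \<and> \<Omega> \<noteq> UNIV \<and> TER_with \<delta>1 R0 Rinf \<Omega> \<longrightarrow>
        (\<exists>\<phi>. \<phi> \<in> borel_measurable (lebesgue_on \<Omega>) \<and> locally_integrable_on \<phi> \<Omega> \<and>
          (\<forall>A \<in> elliptic_matrices (\<nu>\<^sup>2) 1. distr_nonpos \<Omega> (second_order_distr A \<Omega> \<phi>)) \<and>
          (\<forall>x\<in>\<Omega>.
            inverse (N (R0 / Rinf)) * infdist x (frontier \<Omega>) powr (1 - \<epsilon>) \<le> \<phi> x \<and>
            \<phi> x \<le> N (R0 / Rinf) * infdist x (frontier \<Omega>) powr (1 - \<epsilon>)))))"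
proof -
  \<comment> \<open>Chosen so that \<open>4 * \<kappa>\<close> times the trace bound
    \<open>CARD('n)\<close> equals the ellipticity constant \<open>\<nu>\<^sup>2\<close>.\<close>
  define \<kappa> where "\<kappa> = \<nu>\<^sup>2 / (4 * real CARD('n))"
  \<comment> \<open>The solution of \<open>16 * r powr \<epsilon> = \<kappa>\<close>. It depends on
    the dimension, \<open>\<nu>\<close> and \<open>\<epsilon>\<close> alone, and so does
    \<open>r / 2\<close>, the value taken for \<open>\<delta>1\<close>.\<close>
  define r where "r = (\<kappa> / 16) powr (1 / \<epsilon>)"
  define N where "N q = 4 * r powr - (1 - \<epsilon>) + 1 / r * q powr - (1 - \<epsilon>)" for q
  have d: "0 < real CARD('n)" by simp
  have "\<nu>\<^sup>2 \<le> 1" using assms by (simp add: power_le_one)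
  also have "1 \<le> 4 * real CARD('n)" using assms(1) by simp
  finally have \<kappa>: "0 < \<kappa>" "\<kappa> \<le> 1"
    using assms(2) d by (simp_all add: \<kappa>_def)
  have r_pos: "0 < r" using \<kappa> by (simp add: r_def)
  have r_eps: "16 * r powr (1 - (1 - \<epsilon>)) = \<kappa>"
    using \<kappa> assms(4) by (simp add: r_def powr_powr)
  have "r \<le> (\<kappa> / 16) powr 1"
    unfolding r_def using \<kappa> assms(4,5) by (intro powr_mono') auto
  then have r_half: "r \<le> 1/2" using \<kappa> by simp
  show ?thesis
  proof (intro exI[of _ "r / 2"] conjI exI[of _ N] allI impI)
    show "0 < r / 2" "r / 2 \<le> 1" using r_pos r_half by simp_all
    show "0 < N q" for q
      using r_pos by (simp add: N_def add_pos_nonneg)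
    fix \<Omega> :: "(real^'n) set" and R0 Rinf
    assume "domain \<Omega> \<and> \<Omega> \<noteq> UNIV \<and> TER_with (r / 2) R0 Rinf \<Omega>"
    then interpret TER_scales \<Omega> R0 Rinf \<kappa> r "1 - \<epsilon>"
      using \<kappa> r_pos r_half r_eps assms(5) by unfold_locales auto
    have loc: "locally_integrable_on inf_barrier \<Omega>"
      using assms(5) weight_bounds(2)
      by (intro inf_barrier_locally_integrable[of "r powr - (1 - \<epsilon>)" "1 - \<epsilon>"]) auto
    have "distr_nonpos \<Omega> (second_order_distr A \<Omega> inf_barrier)" if A: "A \<in> elliptic_matrices (\<nu>\<^sup>2) 1" for A
    proof -
      obtain v :: "'n \<Rightarrow> real^'n" where v: "\<And>i j. A $ i $ j = (\<Sum>k\<in>UNIV. v k $ i * v k $ j)"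
        "\<And>e. norm e = 1 \<Longrightarrow> \<nu>\<^sup>2 \<le> (\<Sum>k\<in>UNIV. (v k \<bullet> e)\<^sup>2)"
        "(\<Sum>k\<in>UNIV. (norm (v k))\<^sup>2) \<le> real CARD('n)"
        using elliptic_decomposition[OF A] by auto
      have "4 * \<kappa> * (\<Sum>k\<in>UNIV. (norm (v k))\<^sup>2) \<le> 4 * \<kappa> * real CARD('n)"
        using v(3) \<kappa> by (intro mult_left_mono) auto
      also have "\<dots> = \<nu>\<^sup>2" using d by (simp add: \<kappa>_def)
      finally show ?thesis
        using v(2) by (intro inf_barrier_distr_nonpos[OF finite loc v(1)]) (blast intro: order_trans)
    qed
    moreover note inf_barrier_measurable inf_barrier_two_sided[OF _ N_def]
    ultimately show "\<exists>\<phi>. \<phi> \<in> borel_measurable (lebesgue_on \<Omega>) \<and> locally_integrable_on \<phi> \<Omega> \<and>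
          (\<forall>A \<in> elliptic_matrices (\<nu>\<^sup>2) 1. distr_nonpos \<Omega> (second_order_distr A \<Omega> \<phi>)) \<and>
          (\<forall>x\<in>\<Omega>.
            inverse (N (R0 / Rinf)) * infdist x (frontier \<Omega>) powr (1 - \<epsilon>) \<le> \<phi> x \<and>
            \<phi> x \<le> N (R0 / Rinf) * infdist x (frontier \<Omega>) powr (1 - \<epsilon>))"
      using loc by blast
  qed
qed

end
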